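(* For every integer $n\ge 4$, $$\mathrm{indsat}(n,P_4)=\left\lceil\frac{n+1}{3}\right\rceil,$$ where $P_4$ is the path on $4$ vertices.
   Context: A trigraph $T$ is a quadruple $(V(T),EB(T),EW(T),EG(T))$ where $V(T)$ is a finite vertex set and the set of all unordered pairs of distinct vertices is partitioned into $EB(T)$ (black edges), $EW(T)$ (white edges) and $EG(T)$ (gray edges). A realization of $T$ is a graph $G$ with $V(G)=V(T)$ and $E(G)=EB(T)\cup S$ for some $S\subseteq EG(T)$. For a graph $H$, the trigraph $T$ is $H$-induced-saturated if no realization of $T$ contains $H$ as an induced subgraph, but whenever any single black or white edge of $T$ is changed to gray, some realization of the resulting trigraph contains $H$ as an induced subgraph. Define $\mathrm{indsat}(n,H)=\min\{|EG(T)| : |V(T)|=n,\ T \text{ is } H\text{-induced-saturated}\}$. *)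

theory Defs
  imports Complex_Main
begin

definition vertex_pairs :: "'a set \<Rightarrow> 'a set set" where
  "vertex_pairs V = {{u, v} | u v. u \<in> V \<and> v \<in> V \<and> u \<noteq> v}"

record 'a graph =
  verts :: "'a set"
  edges :: "'a set set"

definition graph_iso :: "'a graph \<Rightarrow> 'b graph \<Rightarrow> bool" where
  "graph_iso G H \<longleftrightarrow>
     (\<exists>f. bij_betw f (verts G) (verts H) \<and>
          (\<forall>u \<in> verts G. \<forall>v \<in> verts G. {u, v} \<in> edges G \<longleftrightarrow> {f u, f v} \<in> edges H))"

definition induced_subgraph :: "'a graph \<Rightarrow> 'a set \<Rightarrow> 'a graph" where
  "induced_subgraph G W = \<lparr>verts = W, edges = {e \<in> edges G. e \<subseteq> W}\<rparr>"

definition contains_induced :: "'a graph \<Rightarrow> 'b graph \<Rightarrow> bool" where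
  "contains_induced G H \<longleftrightarrow> (\<exists>W \<subseteq> verts G. graph_iso H (induced_subgraph G W))"

definition path_graph :: "nat \<Rightarrow> nat graph" where
  "path_graph k = \<lparr>verts = {..<k}, edges = {{i, Suc i} | i. Suc i < k}\<rparr>"

record 'a trigraph =
  tverts :: "'a set"
  black :: "'a set set"
  white :: "'a set set"
  gray :: "'a set set"

text \<open>Any of the three edge classes may be empty.\<close>

definition is_trigraph :: "'a trigraph \<Rightarrow> bool" where
  "is_trigraph T \<longleftrightarrow>
     finite (tverts T) \<and>
     black T \<union> white T \<union> gray T = vertex_pairs (tverts T) \<and>
     black T \<inter> white T = {} \<and> black T \<inter> gray T = {} \<and> white T \<inter> gray T = {}"

definition is_realization :: "'a graph \<Rightarrow> 'a trigraph \<Rightarrow> bool" where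
  "is_realization G T \<longleftrightarrow>
     verts G = tverts T \<and> (\<exists>S \<subseteq> gray T. edges G = black T \<union> S)"

definition change_to_gray :: "'a set \<Rightarrow> 'a trigraph \<Rightarrow> 'a trigraph" where
  "change_to_gray e T =
     T\<lparr>black := black T - {e}, white := white T - {e}, gray := insert e (gray T)\<rparr>"

definition induced_saturated :: "'b graph \<Rightarrow> 'a trigraph \<Rightarrow> bool" where
  "induced_saturated H T \<longleftrightarrow>
     is_trigraph T \<and>
     (\<forall>G. is_realization G T \<longrightarrow> \<not> contains_induced G H) \<and>
     (\<forall>e \<in> black T \<union> white T.
        \<exists>G. is_realization G (change_to_gray e T) \<and> contains_induced G H)"

text \<open>
  Vertices are taken to be natural numbers, which represents every finite trigraph up to
  isomorphism. The infimum of a nonempty set of natural numbers is its minimum; the infimum of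
  the empty set is \<open>0\<close>, so a positive value of \<open>indsat n H\<close> entails that
  \<open>H\<close>-induced-saturated trigraphs on \<open>n\<close> vertices exist.
\<close>

definition indsat :: "nat \<Rightarrow> 'b graph \<Rightarrow> nat" where
  "indsat n H =
     Inf {card (gray T) | T :: nat trigraph. card (tverts T) = n \<and> induced_saturated H T}"

end

theory Submission
  imports Defs
begin

text \<open>
  Record a trigraph by two relations on its vertices: \<open>M u v\<close> (the pair is black or gray) and
  \<open>N u v\<close> (white or gray). Complementation swaps \<open>M\<close> and \<open>N\<close> and preserves \<open>P\<^sub>4\<close>.

  Lower bound \<open>n + 1 \<le> 3 g\<close>, by induction on \<open>n\<close>. As for cographs (Seinsche), a trigraph without a
  realizable \<open>P\<^sub>4\<close> falls into two parts joined only by white or only by black pairs, unless it has a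
  gray pair \<open>x y\<close> such that \<open>x\<close> lies on no black and \<open>y\<close> on no white pair. In the exceptional case,
  up to complement, removing \<open>y\<close> and its \<open>k\<close> gray neighbours leaves a saturated trigraph and loses at
  least \<open>k\<close> gray pairs, which gives even \<open>n + 2 \<le> 3 g\<close>; so does a split with both parts of size at
  least 2. If a vertex is joined to the rest only by white pairs, saturation forces each other vertex
  to be the end of a realizable \<open>P\<^sub>3\<close> avoiding it. Hence no further vertex can be peeled off in this
  way, and the stronger inequality applies to the remaining \<open>n - 1\<close> vertices.

  Upper bound: starting from a gray pair, joining a new gray pair to everything by black pairs
  preserves saturation, and such a step may be followed by adding an isolated vertex. This yields 2 or
  3 further vertices per gray pair.
\<close>

section \<open>Trigraphs as pairs of relations\<close>

text \<open>A pair is gray when it lies in both relations, so making it gray applies this one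
  operation to \<open>M\<close> and to \<open>N\<close>.\<close>

definition add_pair :: "'a \<Rightarrow> 'a \<Rightarrow> ('a \<Rightarrow> 'a \<Rightarrow> bool) \<Rightarrow> 'a \<Rightarrow> 'a \<Rightarrow> bool" where
  "add_pair x y M a b \<longleftrightarrow> M a b \<or> (a = x \<and> b = y) \<or> (a = y \<and> b = x)"

definition trirel :: "('a \<Rightarrow> 'a \<Rightarrow> bool) \<Rightarrow> ('a \<Rightarrow> 'a \<Rightarrow> bool) \<Rightarrow> bool" where
  "trirel M N \<longleftrightarrow> (\<forall>u v. M u v \<longrightarrow> M v u) \<and> (\<forall>u v. N u v \<longrightarrow> N v u) \<and>
     (\<forall>u. \<not> M u u) \<and> (\<forall>u. \<not> N u u) \<and> (\<forall>u v. u \<noteq> v \<longrightarrow> M u v \<or> N u v)"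

text \<open>For irreflexive relations the four vertices are automatically distinct.\<close>

definition p4 :: "('a \<Rightarrow> 'a \<Rightarrow> bool) \<Rightarrow> ('a \<Rightarrow> 'a \<Rightarrow> bool) \<Rightarrow> 'a \<Rightarrow> 'a \<Rightarrow> 'a \<Rightarrow> 'a \<Rightarrow> bool" where
  "p4 M N a b c d \<longleftrightarrow> M a b \<and> M b c \<and> M c d \<and> N a c \<and> N b d \<and> N a d"

definition has_p4 :: "('a \<Rightarrow> 'a \<Rightarrow> bool) \<Rightarrow> ('a \<Rightarrow> 'a \<Rightarrow> bool) \<Rightarrow> 'a set \<Rightarrow> bool" where
  "has_p4 M N V \<longleftrightarrow> (\<exists>a\<in>V. \<exists>b\<in>V. \<exists>c\<in>V. \<exists>d\<in>V. p4 M N a b c d)"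

definition saturated :: "('a \<Rightarrow> 'a \<Rightarrow> bool) \<Rightarrow> ('a \<Rightarrow> 'a \<Rightarrow> bool) \<Rightarrow> 'a set \<Rightarrow> bool" where
  "saturated M N V \<longleftrightarrow> \<not> has_p4 M N V \<and>
     (\<forall>u\<in>V. \<forall>v\<in>V. u \<noteq> v \<longrightarrow> \<not> (M u v \<and> N u v) \<longrightarrow> has_p4 (add_pair u v M) (add_pair u v N) V)"

definition gray_pairs :: "('a \<Rightarrow> 'a \<Rightarrow> bool) \<Rightarrow> ('a \<Rightarrow> 'a \<Rightarrow> bool) \<Rightarrow> 'a set \<Rightarrow> 'a set set" where
  "gray_pairs M N V = {{u, v} | u v. u \<in> V \<and> v \<in> V \<and> M u v \<and> N u v}"

text \<open>Disconnectedness of the graph of all pairs that may be edges;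
  \<open>split_by N V\<close> is the same for the pairs that may be non-edges.\<close>

definition split_by :: "('a \<Rightarrow> 'a \<Rightarrow> bool) \<Rightarrow> 'a set \<Rightarrow> bool" where
  "split_by M V \<longleftrightarrow>
     (\<exists>A D. A \<noteq> {} \<and> D \<noteq> {} \<and> A \<inter> D = {} \<and> A \<union> D = V \<and> (\<forall>a\<in>A. \<forall>d\<in>D. \<not> M a d))"

lemma trirel_sym: "trirel M N \<Longrightarrow> M u v \<longleftrightarrow> M v u" "trirel M N \<Longrightarrow> N u v \<longleftrightarrow> N v u"
  by (auto simp: trirel_def)

lemma trirel_irrefl: "trirel M N \<Longrightarrow> \<not> M u u" "trirel M N \<Longrightarrow> \<not> N u u"
  by (auto simp: trirel_def)

lemma trirel_total: "trirel M N \<Longrightarrow> u \<noteq> v \<Longrightarrow> M u v \<or> N u v"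
  by (auto simp: trirel_def)

lemma trirel_swap: "trirel M N \<Longrightarrow> trirel N M"
  by (auto simp: trirel_def)

lemma trirel_add_pair: "trirel M N \<Longrightarrow> u \<noteq> v \<Longrightarrow> trirel (add_pair u v M) (add_pair u v N)"
  unfolding trirel_def add_pair_def by (intro conjI allI impI; elim conjE disjE; blast)

lemma p4_rev: "trirel M N \<Longrightarrow> p4 M N a b c d \<Longrightarrow> p4 M N d c b a"
  by (auto simp: p4_def trirel_def)

text \<open>P_4 is self-complementary: the three non-adjacent pairs of the path
  \<open>a b c d\<close> form the path \<open>b d a c\<close>.\<close>

lemma p4_swap: "trirel M N \<Longrightarrow> p4 N M a b c d \<Longrightarrow> p4 M N b d a c"
  by (auto simp: p4_def trirel_def)

lemma has_p4I: "p4 M N a b c d \<Longrightarrow> {a, b, c, d} \<subseteq> V \<Longrightarrow> has_p4 M N V"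
  by (auto simp: has_p4_def)

lemma has_p4_mono: "has_p4 M N A \<Longrightarrow> A \<subseteq> V \<Longrightarrow> has_p4 M N V"
  unfolding has_p4_def by (meson subsetD)

lemma has_p4_swap: assumes "trirel M N" shows "has_p4 N M V \<longleftrightarrow> has_p4 M N V"
  using p4_swap[OF assms] p4_swap[OF trirel_swap[OF assms]] unfolding has_p4_def by metis

lemma saturated_swap: assumes "trirel M N" shows "saturated N M V \<longleftrightarrow> saturated M N V"
  unfolding saturated_def has_p4_swap[OF assms]
  using has_p4_swap[OF trirel_add_pair[OF assms]] by (metis (no_types, lifting))

lemma gray_pairs_swap: "gray_pairs N M V = gray_pairs M N V"
  by (auto simp: gray_pairs_def)

lemma finite_gray_pairs: "finite V \<Longrightarrow> finite (gray_pairs M N V)"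
  by (rule finite_subset[of _ "Pow V"]) (auto simp: gray_pairs_def)

lemma gray_pairs_mono: "A \<subseteq> V \<Longrightarrow> gray_pairs M N A \<subseteq> gray_pairs M N V"
  by (auto simp: gray_pairs_def)

lemma gray_pairs_Un:
  assumes "finite V" "A \<union> D \<subseteq> V" "A \<inter> D = {}"
  shows "card (gray_pairs M N A) + card (gray_pairs M N D) \<le> card (gray_pairs M N V)"
proof -
  have fin: "finite (gray_pairs M N A)" "finite (gray_pairs M N D)"
    using assms by (auto intro!: finite_gray_pairs intro: finite_subset)
  have "gray_pairs M N A \<inter> gray_pairs M N D = {}"
    using assms(3) by (auto simp: gray_pairs_def doubleton_eq_iff)
  then have "card (gray_pairs M N A) + card (gray_pairs M N D) = card (gray_pairs M N A \<union> gray_pairs M N D)"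
    using fin by (simp add: card_Un_disjoint)
  also have "\<dots> \<le> card (gray_pairs M N V)"
    using assms(1,2) gray_pairs_mono[of A V M N] gray_pairs_mono[of D V M N]
    by (intro card_mono finite_gray_pairs) auto
  finally show ?thesis .
qed

text \<open>A path that misses \<open>u\<close> or \<open>v\<close> does not see the added pair, so
  it would be a P_4 of the original trigraph.\<close>

lemma saturatedD:
  assumes "saturated M N V" "u \<in> V" "v \<in> V" "u \<noteq> v" "\<not> (M u v \<and> N u v)"
  obtains a b c d where "{a, b, c, d} \<subseteq> V" "p4 (add_pair u v M) (add_pair u v N) a b c d"
    "u \<in> {a, b, c, d}" "v \<in> {a, b, c, d}"
proof -
  from assms obtain a b c d where abcd: "a \<in> V" "b \<in> V" "c \<in> V" "d \<in> V"
    and p: "p4 (add_pair u v M) (add_pair u v N) a b c d"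
    unfolding saturated_def has_p4_def by metis
  have "u \<in> {a, b, c, d} \<and> v \<in> {a, b, c, d}"
  proof (rule ccontr)
    assume "\<not> (u \<in> {a, b, c, d} \<and> v \<in> {a, b, c, d})"
    with p have "p4 M N a b c d"
      by (auto simp: p4_def add_pair_def)
    with abcd assms(1) show False
      by (auto simp: saturated_def has_p4_def)
  qed
  with abcd p that show ?thesis by auto
qed

text \<open>Absence of P_4 passes to subsets anyway, so only the location of the P_4 created by a
  pair inside \<open>A\<close> has to be controlled. This is how saturation is inherited in the
  induction.\<close>

lemma saturated_subset:
  assumes "saturated M N V" "A \<subseteq> V"
    and "\<And>u v a b c d. u \<in> A \<Longrightarrow> v \<in> A \<Longrightarrow> u \<noteq> v \<Longrightarrow> {a, b, c, d} \<subseteq> V \<Longrightarrow>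
      p4 (add_pair u v M) (add_pair u v N) a b c d \<Longrightarrow>
      u \<in> {a, b, c, d} \<Longrightarrow> {a, b, c, d} \<subseteq> A"
  shows "saturated M N A"
  unfolding saturated_def
proof (intro conjI ballI impI)
  show "\<not> has_p4 M N A"
    using assms(1) has_p4_mono[OF _ assms(2), of M N] by (auto simp: saturated_def)
next
  fix u v assume *: "u \<in> A" "v \<in> A" "u \<noteq> v" "\<not> (M u v \<and> N u v)"
  with assms(2) have "u \<in> V" "v \<in> V" by auto
  from saturatedD[OF assms(1) this *(3,4)] obtain a b c d where
    "{a, b, c, d} \<subseteq> V" "p4 (add_pair u v M) (add_pair u v N) a b c d" "u \<in> {a, b, c, d}" .
  with assms(3)[OF *(1-3)] show "has_p4 (add_pair u v M) (add_pair u v N) A"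
    by (intro has_p4I) auto
qed

text \<open>P_4 is connected: a pair added inside \<open>A\<close> creates no link to
  \<open>D\<close>, so a path that meets \<open>A\<close> stays in \<open>A\<close>.\<close>

lemma saturated_part:
  assumes "trirel M N" "saturated M N V" "A \<union> D = V" "A \<inter> D = {}" "\<And>a d. a \<in> A \<Longrightarrow> d \<in> D \<Longrightarrow> \<not> M a d"
  shows "saturated M N A"
proof (rule saturated_subset[OF assms(2)])
  show "A \<subseteq> V" using assms by auto
next
  fix u v a b c d
  assume uv: "u \<in> A" "v \<in> A" "u \<noteq> v" and V: "{a, b, c, d} \<subseteq> V"
    and p: "p4 (add_pair u v M) (add_pair u v N) a b c d" and u: "u \<in> {a, b, c, d}"
  have step: "p \<in> A \<longleftrightarrow> q \<in> A" if "add_pair u v M p q" "p \<in> V" "q \<in> V" for p q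
  proof -
    have "add_pair u v M q p" using that trirel_sym(1)[OF trirel_add_pair[OF assms(1) uv(3)]] by metis
    then show ?thesis using that uv assms(3-5) by (auto simp: add_pair_def)
  qed
  from p have "add_pair u v M a b" "add_pair u v M b c" "add_pair u v M c d" by (auto simp: p4_def)
  with step V u uv show "{a, b, c, d} \<subseteq> A" by auto
qed

section \<open>Small saturated trigraphs and stars of gray pairs\<close>

text \<open>A black or white pair would have to create a P_4, which needs four vertices.\<close>

lemma saturated_small_all_gray:
  assumes "trirel M N" "saturated M N V" "finite V" "card V \<le> 3" "u \<in> V" "v \<in> V" "u \<noteq> v"
  shows "M u v \<and> N u v"
proof (rule ccontr)
  assume "\<not> ?thesis"
  from saturatedD[OF assms(2,5,6,7) this] obtain a b c d
    where V: "{a, b, c, d} \<subseteq> V" and p: "p4 (add_pair u v M) (add_pair u v N) a b c d" .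
  have "a \<noteq> b" "b \<noteq> c" "c \<noteq> d" "a \<noteq> c" "b \<noteq> d" "a \<noteq> d"
    using p trirel_irrefl[OF trirel_add_pair[OF assms(1,7)]] by (auto simp: p4_def)
  then have "card {a, b, c, d} = 4" by auto
  moreover have "card {a, b, c, d} \<le> card V" using V assms(3) by (intro card_mono)
  ultimately show False using assms(4) by simp
qed

lemma saturated_two:
  assumes "trirel M N" "saturated M N V" "finite V" "card V = 2"
  shows "card (gray_pairs M N V) \<ge> 1"
proof -
  obtain u v where V: "V = {u, v}" "u \<noteq> v" using assms(4) by (auto simp: card_2_iff)
  with saturated_small_all_gray[OF assms(1-3), of u v] assms(4) have "M u v" "N u v" by auto
  then have "{u, v} \<in> gray_pairs M N V" using V by (auto simp: gray_pairs_def)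
  then show ?thesis using finite_gray_pairs[OF assms(3), of M N] 
    by (metis card_0_eq empty_iff less_one not_le)
qed

text \<open>The pairs \<open>{y, x}\<close> with \<open>x\<close> in \<open>X\<close> are distinct
  and lie inside \<open>insert y X\<close>, hence none of them is counted in
  \<open>R\<close>.\<close>

lemma card_gray_pairs_star:
  assumes "finite V" "trirel M N" "y \<in> V" "X \<subseteq> V" "\<And>x. x \<in> X \<Longrightarrow> M y x \<and> N y x" "R \<subseteq> V"
    "R \<inter> insert y X = {}"
  shows "card X + card (gray_pairs M N R) \<le> card (gray_pairs M N V)"
proof -
  have y: "y \<notin> X" using trirel_irrefl(1)[OF assms(2)] assms(5) by blast
  have "card X = card ((\<lambda>x. {y, x}) ` X)"
    by (rule card_image[symmetric]) (auto simp: inj_on_def doubleton_eq_iff)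
  also have "\<dots> \<le> card (gray_pairs M N (insert y X))"
    by (intro card_mono finite_gray_pairs)
      (use assms in \<open>auto simp: gray_pairs_def intro: finite_subset\<close>)
  finally show ?thesis
    using gray_pairs_Un[OF assms(1), of "insert y X" R M N] assms(3,4,6,7) by (simp add: Int_commute)
qed

lemma saturated_three:
  assumes "trirel M N" "saturated M N V" "finite V" "card V = 3"
  shows "card (gray_pairs M N V) = 3"
proof -
  obtain a b c where V: "V = {a, b, c}" "a \<noteq> b" "b \<noteq> c" "a \<noteq> c"
    using assms(4) by (auto simp: card_3_iff)
  have *: "M u v \<and> N u v" if "u \<in> V" "v \<in> V" "u \<noteq> v" for u v
    using saturated_small_all_gray[OF assms(1-3) _ that] assms(4) by simp
  then have "gray_pairs M N V = {{a, b}, {b, c}, {a, c}}"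
    using trirel_irrefl[OF assms(1)] V unfolding gray_pairs_def by (auto simp: insert_commute)
  then show ?thesis using V by (auto simp: card_insert_if doubleton_eq_iff)
qed

section \<open>Decomposition of trigraphs without a realizable P_4\<close>

text \<open>Seinsche's vertex step. In a graph, a non-neighbour of \<open>v\<close> that is isolated
  in \<open>V\<close> remains isolated after \<open>v\<close> is added. Here its pair with
  \<open>v\<close> may be gray, and this is the only way in which the classical argument
  fails.\<close>

lemma seinsche_step:
  assumes trirel: "trirel M N" and free: "\<not> has_p4 M N (insert v V)" and v: "v \<notin> V"
    and V: "split_by M V" and conn: "\<not> split_by M (insert v V)" "\<not> split_by N (insert v V)"
  shows "\<exists>w\<in>V. (\<forall>u\<in>insert v V - {w}. N w u) \<and> (\<forall>u\<in>V. M v u)"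
proof -
  \<comment> \<open>If \<open>w\<close> had an \<open>M\<close> neighbour in \<open>V\<close>, its
    component \<open>C\<close> would contain an \<open>M\<close> pair \<open>a a'\<close> with
    \<open>v\<close> possibly adjacent to \<open>a\<close> and possibly not to \<open>a'\<close>. A
    neighbour \<open>d\<close> of \<open>v\<close> outside \<open>C\<close> then completes the P_4
    \<open>a' a v d\<close>.\<close>
  have isolated: "\<not> M w w'" if w: "w \<in> V" "N v w" "w' \<in> V" for w w'
  proof
    assume ww': "M w w'"
    define E where "E = (\<lambda>a b. a \<in> V \<and> b \<in> V \<and> M a b)"
    define C where "C = {c \<in> V. E\<^sup>*\<^sup>* w c}"
    have C_step: "c' \<in> C" if "c \<in> C" "c' \<in> V" "M c c'" for c c'
      using that unfolding C_def E_def by (auto intro: rtranclp.rtrancl_into_rtrancl)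
    have wC: "w \<in> C" using w by (auto simp: C_def)
    have w'C: "w' \<in> C" using C_step[OF wC _ ww'] w by auto
    have CV: "C \<subseteq> V" by (auto simp: C_def)
    have "C \<noteq> V"
    proof
      assume CV: "C = V"
      from V obtain A D where AD: "A \<noteq> {}" "D \<noteq> {}" "A \<inter> D = {}" "A \<union> D = V"
        "\<And>a d. a \<in> A \<Longrightarrow> d \<in> D \<Longrightarrow> \<not> M a d" unfolding split_by_def by metis
      have inv: "c \<in> A \<longleftrightarrow> w \<in> A" if "E\<^sup>*\<^sup>* w c" for c
        using that
      proof induction
        case (step y z)
        then have "M y z" "M z y" "y \<in> A \<union> D" "z \<in> A \<union> D"
          using AD trirel_sym(1)[OF trirel, of y z] unfolding E_def by auto
        then show ?case using AD(3,5) step.IH by blast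
      qed simp
      then have "c \<in> A \<longleftrightarrow> w \<in> A" if "c \<in> V" for c
        using CV that inv unfolding C_def by blast
      then show False using AD by blast
    qed
    have "\<exists>c\<in>C. M v c"
    proof (rule ccontr)
      assume "\<not> ?thesis"
      then have "\<not> M c d" if "c \<in> C" "d \<in> insert v V - C" for c d
        using that C_step[of c d] trirel_sym(1)[OF trirel, of c d] by auto
      then have "split_by M (insert v V)"
        unfolding split_by_def using wC CV v
        by (intro exI[of _ C] exI[of _ "insert v V - C"]) auto
      then show False using conn by simp
    qed
    then obtain c0 where c0: "c0 \<in> C" "M v c0" by auto
    have "\<exists>d\<in>V - C. M v d"
    proof (rule ccontr)
      assume "\<not> ?thesis"
      then have "\<not> M c d" if "c \<in> insert v C" "d \<in> V - C" for c d
        using that C_step[of c d] by auto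
      then have "split_by M (insert v V)"
        unfolding split_by_def using wC CV v \<open>C \<noteq> V\<close>
        by (intro exI[of _ "insert v C"] exI[of _ "V - C"]) auto
      then show False using conn by simp
    qed
    then obtain d where d: "d \<in> V" "d \<notin> C" "M v d" by auto
    have "\<exists>a\<in>C. \<exists>a'\<in>C. M v a \<and> N v a' \<and> M a a'"
    proof (cases "\<forall>c\<in>C. M v c")
      \<comment> \<open>Now \<open>v w\<close> is gray, so \<open>w\<close> can serve as the
        non-neighbour \<open>a'\<close> although \<open>v\<close> may be adjacent to all of
        \<open>C\<close>.\<close>
      case True
      then show ?thesis using w'C wC w ww' trirel_sym(1)[OF trirel] by blast
    next
      case False
      then obtain c1 where c1: "c1 \<in> C" "\<not> M v c1" by auto
      define P where "P = {c \<in> C. M v c}"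
      \<comment> \<open>\<open>P\<close> contains \<open>c0\<close> but not \<open>c1\<close>; since
        the component \<open>C\<close> is connected, some \<open>M\<close> pair must leave
        \<open>P\<close> inside \<open>C\<close>.\<close>
      have "\<exists>a\<in>P. \<exists>a'\<in>C - P. M a a'"
      proof (rule ccontr)
        assume no: "\<not> ?thesis"
        have inv: "c \<in> P \<longleftrightarrow> w \<in> P" if "E\<^sup>*\<^sup>* w c" for c
          using that
        proof induction
          case (step y z)
          then have "y \<in> C" unfolding C_def E_def by auto
          moreover from this have "z \<in> C" using C_step[of y z] step.hyps unfolding E_def by auto
          ultimately have "y \<in> C" "z \<in> C" .
          then show ?case using step no trirel_sym(1)[OF trirel, of y z] unfolding E_def by blast
        qed simp
        then show False using c0 c1 unfolding P_def C_def by blast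
      qed
      then obtain a a' where "a \<in> P" "a' \<in> C" "a' \<notin> P" "M a a'" by blast
      moreover have "v \<noteq> a'" using v \<open>a' \<in> C\<close> CV by auto
      ultimately show ?thesis using trirel_total[OF trirel, of v a'] unfolding P_def by blast
    qed
    then obtain a a' where a: "a \<in> C" "a' \<in> C" "M v a" "N v a'" "M a a'" by blast
    have "N c d" if "c \<in> C" for c
      using that C_step[of c d] d trirel_total[OF trirel, of c d] by auto
    then have "p4 M N a' a v d"
      using a d trirel_sym[OF trirel] by (auto simp: p4_def)
    then show False using free a CV d by (auto dest!: has_p4I[where V = "insert v V"])
  qed
  \<comment> \<open>A vertex \<open>u\<close> white to \<open>v\<close> would be isolated in
    \<open>V\<close> by the previous claim, hence isolated altogether.\<close>
  have adj: "M v u" if "u \<in> V" for u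
  proof (rule ccontr)
    assume no: "\<not> M v u"
    then have "N v u" using trirel_total[OF trirel, of v u] v that by auto
    then have "\<not> M u d" if "d \<in> insert v V - {u}" for d
      using isolated[OF \<open>u \<in> V\<close>, of d] that no trirel_sym(1)[OF trirel] by auto
    then have "split_by M (insert v V)"
      unfolding split_by_def using v that
      by (intro exI[of _ "{u}"] exI[of _ "insert v V - {u}"]) auto
    then show False using conn by simp
  qed
  have "\<exists>w\<in>V. N v w"
  proof (rule ccontr)
    assume "\<not> ?thesis"
    moreover have "V \<noteq> {}" using V by (auto simp: split_by_def)
    ultimately have "split_by N (insert v V)"
      unfolding split_by_def using v by (intro exI[of _ "{v}"] exI[of _ V]) auto
    then show False using conn by simp
  qed
  then obtain w where w: "w \<in> V" "N v w" by auto
  have "N w u" if "u \<in> insert v V - {w}" for u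
    using that isolated[OF w, of u] w trirel_total[OF trirel, of w u] trirel_sym(2)[OF trirel] by auto
  then show ?thesis using w adj by auto
qed

text \<open>The obstruction to splitting. Taking \<open>u = y\<close> in the first condition and
  \<open>u = x\<close> in the second shows that, for symmetric relations, \<open>x y\<close> is
  itself gray; the complement exchanges \<open>x\<close> and \<open>y\<close>.\<close>

definition hinge :: "('a \<Rightarrow> 'a \<Rightarrow> bool) \<Rightarrow> ('a \<Rightarrow> 'a \<Rightarrow> bool) \<Rightarrow> 'a set \<Rightarrow> 'a \<Rightarrow> 'a \<Rightarrow> bool" where
  "hinge M N V x y \<longleftrightarrow> x \<in> V \<and> y \<in> V \<and> x \<noteq> y \<and> (\<forall>u\<in>V - {x}. N x u) \<and> (\<forall>u\<in>V - {y}. M y u)"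

text \<open>The black pair \<open>x v\<close> spoils the hinge \<open>x y\<close>. If
  \<open>y v\<close> may be a non-edge, any further vertex \<open>z\<close> yields a P_4 on
  \<open>v, x, y, z\<close>, directly or in the complement according to \<open>v z\<close>; so
  \<open>V\<close> is just \<open>{x, y}\<close> and the two roles swap. If \<open>y v\<close> is
  black as well, a possible non-neighbour \<open>z\<close> of \<open>v\<close> gives the P_4
  \<open>x v y z\<close>, so \<open>v\<close> is black to all of \<open>V\<close>.\<close>

lemma hinge_step:
  assumes trirel: "trirel M N" and free: "\<not> has_p4 M N (insert v V)" and v: "v \<notin> V"
    and xy: "hinge M N V x y" and x: "\<not> N x v"
  shows "split_by N (insert v V) \<or> (\<exists>x y. hinge M N (insert v V) x y)"
proof -
  note sym = trirel_sym[OF trirel]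
  have xv: "M x v" "M v x"
    using trirel_total[OF trirel, of x v] x v xy sym(1)[of x v] by (auto simp: hinge_def)
  have free': "\<not> has_p4 N M (insert v V)" using free has_p4_swap[OF trirel] by simp
  have in_V: "x \<in> V" "y \<in> V" "x \<noteq> y"
    and N_x: "u \<in> V \<Longrightarrow> u \<noteq> x \<Longrightarrow> N x u" "u \<in> V \<Longrightarrow> u \<noteq> x \<Longrightarrow> N u x"
    and M_y: "u \<in> V \<Longrightarrow> u \<noteq> y \<Longrightarrow> M y u" "u \<in> V \<Longrightarrow> u \<noteq> y \<Longrightarrow> M u y" for u
    using xy sym(1)[of y u] sym(2)[of x u] by (auto simp: hinge_def)
  show ?thesis
  proof (cases "N y v")
    case True
    have Mv: "M v z" if z: "z \<in> V - {x, y}" for z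
    proof (rule ccontr)
      assume "\<not> M v z"
      then have "N v z" using trirel_total[OF trirel, of v z] z v by auto
      then have "p4 M N v x y z"
        using z v in_V N_x M_y xv True sym(2)[of y v] by (auto simp: p4_def)
      then show False using free z in_V by (auto dest!: has_p4I[where V = "insert v V"])
    qed
    have "V = {x, y}"
    proof (rule ccontr)
      assume "V \<noteq> {x, y}"
      then obtain z where z: "z \<in> V - {x, y}" using in_V by blast
      then have "p4 N M v y x z"
        using Mv[OF z] v in_V N_x M_y xv True sym(2)[of y v] by (auto simp: p4_def)
      then show False using free' z in_V by (auto dest!: has_p4I[where V = "insert v V"])
    qed
    then have "hinge M N (insert v V) y x"
      using in_V xv True v N_x M_y by (auto simp: hinge_def)
    then show ?thesis by blast
  next
    case False
    then have yv: "M y v" "M v y" using trirel_total[OF trirel, of y v] v in_V sym(1)[of y v] by auto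
    have "\<not> N v z" if z: "z \<in> V" for z
    proof
      assume vz: "N v z"
      then have "z \<noteq> x" "z \<noteq> y" using x False sym(2)[of v] by auto
      then have "p4 M N x v y z"
        using vz z in_V N_x M_y xv yv by (auto simp: p4_def)
      then show False using free z in_V by (auto dest!: has_p4I[where V = "insert v V"])
    qed
    then have "split_by N (insert v V)"
      unfolding split_by_def using v in_V by (intro exI[of _ "{v}"] exI[of _ V]) auto
    then show ?thesis by blast
  qed
qed

lemma hinge_swap: "hinge N M V x y \<longleftrightarrow> hinge M N V y x"
  by (auto simp: hinge_def)

text \<open>Vertices are added one at a time. \<open>seinsche_step\<close> treats a split of the
  smaller set, and a hinge survives unless \<open>v\<close> violates one of its two conditions;
  either violation is \<open>hinge_step\<close>, up to complement.\<close>

lemma has_p4_free_cases: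
  assumes trirel: "trirel M N" and "finite V" "card V \<ge> 2" "\<not> has_p4 M N V"
  shows "split_by M V \<or> split_by N V \<or> (\<exists>x y. hinge M N V x y)"
  using assms(2-4)
proof (induction V rule: finite_induct)
  case (insert v V)
  have free: "\<not> has_p4 M N (insert v V)" "\<not> has_p4 N M (insert v V)"
    using insert.prems has_p4_swap[OF trirel] by auto
  show ?case
  proof (cases "card V \<ge> 2")
    case False
    then have "card V = 1" using insert by auto
    then obtain w where w: "V = {w}" by (auto simp: card_1_singleton_iff)
    consider "\<not> M v w" | "\<not> N v w" | "M v w" "N v w" by blast
    then show ?thesis
    proof cases
      case 1
      then have "split_by M (insert v V)" unfolding split_by_def using w insert
        by (intro exI[of _ "{v}"] exI[of _ V]) auto
      then show ?thesis ..
    next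
      case 2
      then have "split_by N (insert v V)" unfolding split_by_def using w insert
        by (intro exI[of _ "{v}"] exI[of _ V]) auto
      then show ?thesis by blast
    next
      case 3
      then have "hinge M N (insert v V) w v"
        using w insert trirel_sym[OF trirel] by (auto simp: hinge_def)
      then show ?thesis by blast
    qed
  next
    case True
    have "\<not> has_p4 M N V" using has_p4_mono[of M N V "insert v V"] free by auto
    with insert.IH True
    consider "split_by M V" | "split_by N V" | x y where "hinge M N V x y" by blast
    then show ?thesis
    proof cases
      case 1
      show ?thesis
      proof (rule ccontr)
        assume no: "\<not> ?thesis"
        with seinsche_step[OF trirel free(1) insert(2) 1] obtain w
          where "w \<in> V" "\<forall>u\<in>insert v V - {w}. N w u" "\<forall>u\<in>V. M v u" by blast
        then have "hinge M N (insert v V) w v" using insert(2) by (auto simp: hinge_def)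
        with no show False by blast
      qed
    next
      case 2
      show ?thesis
      proof (rule ccontr)
        assume no: "\<not> ?thesis"
        with seinsche_step[OF trirel_swap[OF trirel] free(2) insert(2) 2] obtain w
          where "w \<in> V" "\<forall>u\<in>insert v V - {w}. M w u" "\<forall>u\<in>V. N v u" by blast
        then have "hinge M N (insert v V) v w" using insert(2) by (auto simp: hinge_def)
        with no show False by blast
      qed
    next
      case 3
      show ?thesis
      proof (cases "N x v")
        case xv: True
        show ?thesis
        proof (cases "M y v")
          case True
          with xv 3 have "hinge M N (insert v V) x y" by (auto simp: hinge_def)
          then show ?thesis by blast
        next
          case False
          from hinge_step[OF trirel_swap[OF trirel] free(2) insert(2) _ False] 3
          show ?thesis unfolding hinge_swap[of N M] by blast
        qed
      next
        case False
        from hinge_step[OF trirel free(1) insert(2) 3 False] show ?thesis by blast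
      qed
    qed
  qed
qed simp

section \<open>Gray pairs in the hinge and split cases\<close>

text \<open>The pair \<open>a b\<close>, or a pair \<open>a r\<close> with a fourth vertex
  \<open>r\<close>, completes a P_4 in one of the two relations whatever its colour. Hence on four
  or more vertices \<open>x y\<close> is the only gray pair at \<open>x\<close> or the only one at
  \<open>y\<close>, and the complement reduces the second case to the first.\<close>

lemma hinge_triangle:
  assumes trirel: "trirel M N" and free: "\<not> has_p4 M N V" and xy: "hinge M N V x y"
    and a: "a \<in> V" "a \<noteq> x" "a \<noteq> y" "M x a" and b: "b \<in> V" "b \<noteq> x" "b \<noteq> y" "N y b"
  shows "V = {x, y, a}"
proof (rule ccontr)
  assume no: "V \<noteq> {x, y, a}"
  note sym = trirel_sym[OF trirel]
  have free': "\<not> has_p4 N M V" using free has_p4_swap[OF trirel] by simp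
  have in_V: "x \<in> V" "y \<in> V" "x \<noteq> y"
    and N_x: "u \<in> V \<Longrightarrow> u \<noteq> x \<Longrightarrow> N x u" "u \<in> V \<Longrightarrow> u \<noteq> x \<Longrightarrow> N u x"
    and M_y: "u \<in> V \<Longrightarrow> u \<noteq> y \<Longrightarrow> M y u" "u \<in> V \<Longrightarrow> u \<noteq> y \<Longrightarrow> M u y" for u
    using xy sym(1)[of y u] sym(2)[of x u] by (auto simp: hinge_def)
  have ab: "M a x" "N b y" using a b sym by auto
  have "a = b"
  proof (rule ccontr)
    assume "a \<noteq> b"
    then consider "N a b" "N b a" | "M a b" "M b a" using trirel_total[OF trirel] sym by metis
    then show False
    proof cases
      case 1
      then have "p4 M N b y a x" using a b ab in_V N_x M_y by (auto simp: p4_def)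
      then show False using free a b in_V by (auto dest!: has_p4I[where V = V])
    next
      case 2
      then have "p4 N M a x b y" using a b ab in_V N_x M_y by (auto simp: p4_def)
      then show False using free' a b in_V by (auto dest!: has_p4I[where V = V])
    qed
  qed
  obtain r where r: "r \<in> V" "r \<noteq> x" "r \<noteq> y" "r \<noteq> a" using no in_V a by blast
  then consider "N a r" "N r a" | "M a r" "M r a" using trirel_total[OF trirel] sym by metis
  then show False
  proof cases
    case 1
    then have "p4 M N r y a x" using a ab r in_V N_x M_y by (auto simp: p4_def)
    then show False using free a r in_V by (auto dest!: has_p4I[where V = V])
  next
    case 2
    then have "p4 N M r x a y" using a b ab \<open>a = b\<close> r in_V N_x M_y by (auto simp: p4_def)
    then show False using free' a r in_V by (auto dest!: has_p4I[where V = V])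
  qed
qed

text \<open>The vertex \<open>x\<close> hangs on \<open>y\<close> alone. If some vertex is black to
  \<open>y\<close>, excluding P_4 forces every gray neighbour of \<open>y\<close> to hang on
  \<open>y\<close> in the same way, so a P_4 created elsewhere can use neither these vertices nor
  \<open>y\<close>.\<close>

lemma hinge_pendant_gray_bound:
  assumes trirel: "trirel M N" and saturated: "saturated M N V" and fin: "finite V" and card: "card V \<ge> 4"
    and xy: "hinge M N V x y" and x: "\<And>a. a \<in> V \<Longrightarrow> a \<noteq> x \<Longrightarrow> a \<noteq> y \<Longrightarrow> \<not> M x a"
    and IH: "\<And>R. R \<subset> V \<Longrightarrow> saturated M N R \<Longrightarrow> card R \<ge> 2 \<Longrightarrow> card R + 1 \<le> 3 * card (gray_pairs M N R)"
  shows "card V + 2 \<le> 3 * card (gray_pairs M N V)"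
proof -
  note sym = trirel_sym[OF trirel]
  have free: "\<not> has_p4 M N V" using saturated by (simp add: saturated_def)
  have in_V: "x \<in> V" "y \<in> V" "x \<noteq> y"
    and N_x: "u \<in> V \<Longrightarrow> u \<noteq> x \<Longrightarrow> N x u" "u \<in> V \<Longrightarrow> u \<noteq> x \<Longrightarrow> N u x"
    and M_y: "u \<in> V \<Longrightarrow> u \<noteq> y \<Longrightarrow> M y u" "u \<in> V \<Longrightarrow> u \<noteq> y \<Longrightarrow> M u y" for u
    using xy sym(1)[of y u] sym(2)[of x u] by (auto simp: hinge_def)
  \<comment> \<open>Since \<open>y\<close> has no white pair, \<open>X\<close> is the set of its
    gray neighbours and \<open>R\<close> the set of its black neighbours.\<close>
  define X where "X = {u \<in> V. N y u}"
  define R where "R = V - insert y X"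
  have yX: "y \<notin> X" using trirel_irrefl(2)[OF trirel] by (auto simp: X_def)
  have xX: "x \<in> X" using in_V N_x(2)[of y] by (auto simp: X_def)
  have XV: "X \<subseteq> V" and RV: "R \<subset> V" using in_V by (auto simp: X_def R_def)
  have finX: "finite X" "finite R" using fin XV RV by (auto intro: finite_subset)
  have cardV: "card V = card X + card R + 1"
  proof -
    have "V = insert y (X \<union> R)" "y \<notin> X \<union> R" "X \<inter> R = {}"
      using XV RV in_V yX by (auto simp: R_def)
    then show ?thesis using finX by (simp add: card_Un_disjoint)
  qed
  have X1: "card X \<ge> 1" using xX finX by (metis card_0_eq empty_iff less_one not_le)
  have g: "card X + card (gray_pairs M N R) \<le> card (gray_pairs M N V)"
    by (rule card_gray_pairs_star[OF fin trirel in_V(2) XV])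
      (use XV RV yX M_y in \<open>auto simp: R_def X_def\<close>)
  \<comment> \<open>Here |V| = |X| + |R| + 1. For |R| <= 1 the star alone suffices, because |V| >= 4
    gives |X| >= 2; for larger \<open>R\<close> the induction bound of \<open>R\<close> is added and
    |X| >= 1 is enough.\<close>
  show ?thesis
  proof (cases "R = {}")
    case True
    then show ?thesis using g card cardV by simp
  next
    case False
    have R: "M y r" "\<not> N y r" "r \<in> V" "r \<noteq> x" "r \<noteq> y" if "r \<in> R" for r
      using that M_y xX by (auto simp: R_def X_def)
    have XR: "\<not> M x' r" if "x' \<in> X" "r \<in> R" for x' r
    proof
      assume *: "M x' r"
      show False
      proof (cases "x' = x")
        case True
        then show False using * x R[OF that(2)] by auto
      next
        case False
        then have "p4 M N x y r x'"
          using * sym(1)[of x' r] sym(2)[of y x'] R[OF that(2)] that in_V N_x M_y by (auto simp: p4_def X_def)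
        then show False using free that in_V R[OF that(2)]
          by (auto simp: X_def dest!: has_p4I[where V = V])
      qed
    qed
    have XX: "\<not> M x' x''" if "x' \<in> X" "x'' \<in> X" for x' x''
    proof
      assume *: "M x' x''"
      obtain r where r: "r \<in> R" using False by auto
      have "r \<noteq> x'" "r \<noteq> x''" using that r by (auto simp: R_def)
      then have "N x' r" "N x'' r" using XR[OF that(1) r] XR[OF that(2) r] trirel_total[OF trirel] by metis+
      moreover have "x' \<noteq> y" using that yX by auto
      ultimately have "p4 M N x'' x' y r"
        using * sym(1)[of x' x''] sym(2)[of y x''] R[OF r] that in_V M_y[of x'] by (auto simp: p4_def X_def)
      then show False using free that in_V R[OF r]
        by (auto simp: X_def dest!: has_p4I[where V = V])
    qed
    have "saturated M N R"
    proof (rule saturated_subset[OF saturated])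
      show "R \<subseteq> V" using RV by auto
    next
      fix u v a b c d
      assume uv: "u \<in> R" "v \<in> R" "u \<noteq> v" and V: "{a, b, c, d} \<subseteq> V"
        and p: "p4 (add_pair u v M) (add_pair u v N) a b c d" and u: "u \<in> {a, b, c, d}"
      have trirel': "trirel (add_pair u v M) (add_pair u v N)" using trirel_add_pair[OF trirel uv(3)] .
      \<comment> \<open>If an end \<open>s\<close> is in \<open>X\<close>, its neighbour
        \<open>t\<close> is \<open>y\<close>. The other end \<open>q\<close> must be a possible
        non-neighbour of \<open>y\<close>, so it is in \<open>X\<close> too and its neighbour
        \<open>p\<close> is again \<open>y\<close>.\<close>
      have not_X: "s \<notin> X" if "p4 (add_pair u v M) (add_pair u v N) s t p q"
        "{s, t, p, q} \<subseteq> V" for s t p q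
      proof
        assume s: "s \<in> X"
        have M_X: "q' = y" if "add_pair u v M p' q'" "p' \<in> X" "q' \<in> V" for p' q'
        proof (rule ccontr)
          assume "q' \<noteq> y"
          then have "q' \<in> X \<or> q' \<in> R" using that by (auto simp: R_def)
          moreover have "p' \<notin> R" using that by (auto simp: R_def)
          ultimately show False using that XX XR uv by (auto simp: add_pair_def)
        qed
        have st: "add_pair u v M s t" "add_pair u v M t p" "add_pair u v M p q" "add_pair u v N t q"
          using that by (auto simp: p4_def)
        have t: "t = y" using M_X[OF st(1) s] that by auto
        have "q \<noteq> y" using st t trirel_irrefl(2)[OF trirel'] by auto
        have "q \<notin> R"
          using st(4) t R[of q] uv R(5)[of u] R(5)[of v] by (auto simp: add_pair_def)
        then have "q \<in> X" using \<open>q \<noteq> y\<close> that by (auto simp: R_def)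
        then have "p = y" using M_X[of q p] st that trirel_sym(1)[OF trirel'] by auto
        then show False using t st trirel_irrefl(1)[OF trirel'] by auto
      qed
      \<comment> \<open>An inner vertex in \<open>X\<close> would need two distinct neighbours, but
        \<open>y\<close> is the only one.\<close>
      have mid: "t \<notin> X" if "p4 (add_pair u v M) (add_pair u v N) s t p q" "{s, t, p, q} \<subseteq> V" for s t p q
      proof
        assume t: "t \<in> X"
        have st: "add_pair u v M t s" "add_pair u v M t p" "add_pair u v N s p"
          using that trirel_sym(1)[OF trirel'] by (auto simp: p4_def)
        have "z = y" if "add_pair u v M t z" "z \<in> V" for z
        proof (rule ccontr)
          assume "z \<noteq> y"
          then have "z \<in> X \<or> z \<in> R" using that by (auto simp: R_def)
          moreover have "t \<notin> R" using t by (auto simp: R_def)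
          ultimately show False using that XX XR uv t by (auto simp: add_pair_def)
        qed
        then have "s = y" "p = y" using st that by auto
        then show False using st trirel_irrefl(2)[OF trirel'] by auto
      qed
      have rp: "p4 (add_pair u v M) (add_pair u v N) d c b a" using p4_rev[OF trirel' p] .
      have nX: "a \<notin> X" "b \<notin> X" "c \<notin> X" "d \<notin> X"
        using not_X[OF p] mid[OF p] not_X[OF rp] mid[OF rp] V by auto
      \<comment> \<open>Every vertex of a P_4 has a non-neighbour on it, whereas outside
        \<open>X\<close> the vertex \<open>y\<close> has none; so \<open>y\<close> is not on the
        path.\<close>
      have N_y: "\<not> add_pair u v N y q" if "q \<in> V" "q \<notin> X" for q
        using that trirel_irrefl(2)[OF trirel] uv R(5)[of u] R(5)[of v] by (auto simp: add_pair_def X_def)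
      have "add_pair u v N a c" "add_pair u v N c a" "add_pair u v N b d" "add_pair u v N d b"
        using p trirel_sym(2)[OF trirel'] by (auto simp: p4_def)
      then have "a \<noteq> y" "b \<noteq> y" "c \<noteq> y" "d \<noteq> y" using N_y V nX by auto
      then show "{a, b, c, d} \<subseteq> R" using V nX by (auto simp: R_def)
    qed
    show ?thesis
    proof (cases "card R \<ge> 2")
      case True
      from IH[OF RV \<open>saturated M N R\<close> this] show ?thesis using g cardV X1 by linarith
    next
      case False
      then show ?thesis using g cardV card by linarith
    qed
  qed
qed

lemma hinge_gray_bound:
  assumes trirel: "trirel M N" and saturated: "saturated M N V" and fin: "finite V" and card: "card V \<ge> 3"
    and xy: "hinge M N V x y"
    and IH: "\<And>R. R \<subset> V \<Longrightarrow> saturated M N R \<Longrightarrow> card R \<ge> 2 \<Longrightarrow> card R + 1 \<le> 3 * card (gray_pairs M N R)"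
  shows "card V + 2 \<le> 3 * card (gray_pairs M N V)"
proof (cases "card V = 3")
  case True
  then show ?thesis using saturated_three[OF trirel saturated fin] by simp
next
  case False
  then have card4: "card V \<ge> 4" using card by simp
  have "V \<noteq> {x, y, a}" for a
  proof
    assume "V = {x, y, a}"
    then have "card V \<le> 3" by (simp add: card_insert_if)
    then show False using card4 by simp
  qed
  then consider "\<And>a. a \<in> V \<Longrightarrow> a \<noteq> x \<Longrightarrow> a \<noteq> y \<Longrightarrow> \<not> M x a"
    | "\<And>a. a \<in> V \<Longrightarrow> a \<noteq> y \<Longrightarrow> a \<noteq> x \<Longrightarrow> \<not> N y a"
    using hinge_triangle[OF trirel _ xy] saturated by (metis saturated_def)
  then show ?thesis
  proof cases
    case 1
    then show ?thesis using hinge_pendant_gray_bound[OF trirel saturated fin card4 xy _ IH] by blast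
  next
    case 2
    then show ?thesis
      using hinge_pendant_gray_bound[OF trirel_swap[OF trirel], of V y x] saturated fin card4 xy IH
      unfolding saturated_swap[OF trirel] hinge_swap[of N M] gray_pairs_swap[of N M] by blast
  qed
qed

text \<open>Adding the bounds of the two parts adds up both \<open>+ 1\<close>, which yields the
  stronger \<open>+ 2\<close>. A part with a single vertex has no such bound and is reported as the
  alternative.\<close>

lemma split_gray_bound:
  assumes trirel: "trirel M N" and saturated: "saturated M N V" and fin: "finite V" and split: "split_by M V"
    and IH: "\<And>R. R \<subset> V \<Longrightarrow> saturated M N R \<Longrightarrow> card R \<ge> 2 \<Longrightarrow> card R + 1 \<le> 3 * card (gray_pairs M N R)"
  shows "card V + 2 \<le> 3 * card (gray_pairs M N V) \<or> (\<exists>v\<in>V. \<forall>u\<in>V - {v}. \<not> M v u)"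
proof -
  from split obtain A D where AD: "A \<noteq> {}" "D \<noteq> {}" "A \<inter> D = {}" "A \<union> D = V"
    and M: "\<And>a d. a \<in> A \<Longrightarrow> d \<in> D \<Longrightarrow> \<not> M a d" unfolding split_by_def by metis
  have fins: "finite A" "finite D" using AD fin by (auto intro: finite_subset)
  then have c: "card A \<ge> 1" "card D \<ge> 1" using AD by (metis card_0_eq less_one not_le)+
  have "\<not> M d a" if "d \<in> D" "a \<in> A" for d a using M[OF that(2,1)] trirel_sym(1)[OF trirel] by blast
  then have sats: "saturated M N A" "saturated M N D"
    using saturated_part[OF trirel saturated AD(4,3) M] saturated_part[OF trirel saturated, of D A] AD by (auto simp: Un_commute Int_commute)
  consider "card A = 1" | "card D = 1" | "card A \<ge> 2" "card D \<ge> 2" using c by linarith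
  then show ?thesis
  proof cases
    case 1
    then obtain v where "A = {v}" by (auto simp: card_1_singleton_iff)
    then show ?thesis using AD M by blast
  next
    case 2
    then obtain v where "D = {v}" by (auto simp: card_1_singleton_iff)
    then show ?thesis using AD M trirel_sym(1)[OF trirel] by blast
  next
    case 3
    then have "card A + 1 \<le> 3 * card (gray_pairs M N A)" "card D + 1 \<le> 3 * card (gray_pairs M N D)"
      using IH[OF _ sats(1)] IH[OF _ sats(2)] AD by blast+
    moreover have "card V = card A + card D" using AD fins by (auto simp: card_Un_disjoint)
    moreover have "card (gray_pairs M N A) + card (gray_pairs M N D) \<le> card (gray_pairs M N V)"
      using AD fin by (intro gray_pairs_Un) auto
    ultimately show ?thesis by linarith
  qed
qed

lemma gray_bound_or_extreme_vertex:
  assumes trirel: "trirel M N" and saturated: "saturated M N V" and fin: "finite V" and card: "card V \<ge> 3"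
    and IH: "\<And>R. R \<subset> V \<Longrightarrow> saturated M N R \<Longrightarrow> card R \<ge> 2 \<Longrightarrow> card R + 1 \<le> 3 * card (gray_pairs M N R)"
  shows "card V + 2 \<le> 3 * card (gray_pairs M N V) \<or>
    (\<exists>v\<in>V. (\<forall>u\<in>V - {v}. \<not> M v u) \<or> (\<forall>u\<in>V - {v}. \<not> N v u))"
proof -
  have "\<not> has_p4 M N V" "card V \<ge> 2" using saturated card by (auto simp: saturated_def)
  with has_p4_free_cases[OF trirel fin]
  consider "split_by M V" | "split_by N V" | x y where "hinge M N V x y" by blast
  then show ?thesis
  proof cases
    case 1
    then show ?thesis using split_gray_bound[OF trirel saturated fin 1 IH] by blast
  next
    case 2
    then show ?thesis
      using split_gray_bound[OF trirel_swap[OF trirel], of V] saturated fin IH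
      unfolding saturated_swap[OF trirel] gray_pairs_swap[of N M] by blast
  next
    case 3
    then show ?thesis using hinge_gray_bound[OF trirel saturated fin card 3 IH] by blast
  qed
qed

section \<open>Extreme vertices and the lower bound\<close>

text \<open>Once \<open>v d\<close> is gray, \<open>d\<close> is the only possible neighbour of
  \<open>v\<close>. The resulting P_4 therefore starts \<open>v d\<close>, and deleting
  \<open>v\<close> leaves a P_3 with end \<open>d\<close>.\<close>

lemma isolated_imp_p3_end:
  assumes trirel: "trirel M N" and saturated: "saturated M N V" and v: "v \<in> V" "\<And>u. u \<in> V \<Longrightarrow> \<not> M v u"
    and d: "d \<in> V" "d \<noteq> v"
  obtains a b where "a \<in> V - {v}" "b \<in> V - {v}" "M d a" "M a b" "N d b"
proof -
  note result = that
  have trirel': "trirel (add_pair v d M) (add_pair v d N)" using trirel_add_pair[OF trirel] d by auto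
  note sym' = trirel_sym[OF trirel'] and irr' = trirel_irrefl[OF trirel']
  have "v \<noteq> d" "\<not> (M v d \<and> N v d)" using v(2)[OF d(1)] d by auto
  from saturatedD[OF saturated v(1) d(1) this] obtain a b c e
    where V: "{a, b, c, e} \<subseteq> V" and p: "p4 (add_pair v d M) (add_pair v d N) a b c e"
      and vin: "v \<in> {a, b, c, e}" .
  have Mv: "z = d" if "add_pair v d M v z" "z \<in> V" for z
    using that v(2)[of z] d by (auto simp: add_pair_def)
  have mid: "t \<noteq> v" if "p4 (add_pair v d M) (add_pair v d N) s t p q" "{s, t, p, q} \<subseteq> V" for s t p q
  proof
    assume "t = v"
    then have "s = d" "p = d" using that Mv sym' by (auto simp: p4_def)
    then show False using that irr' by (auto simp: p4_def)
  qed
  have *: thesis if p: "p4 (add_pair v d M) (add_pair v d N) v s t q" "{v, s, t, q} \<subseteq> V" for s t q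
  proof -
    have s: "s = d" using p Mv by (auto simp: p4_def)
    have "t \<noteq> v" "q \<noteq> v" using p irr' by (auto simp: p4_def)
    then have "M d t" "M t q" "N d q" using p s d by (auto simp: p4_def add_pair_def)
    then show thesis using result[of t q] p \<open>t \<noteq> v\<close> \<open>q \<noteq> v\<close> by auto
  qed
  have "p4 (add_pair v d M) (add_pair v d N) e c b a" using p4_rev[OF trirel' p] .
  then show thesis using * mid p V vin by fastforce
qed

text \<open>Being the end of a P_3 inside \<open>R\<close> gives each vertex of \<open>R\<close>
  both an \<open>M\<close> and an \<open>N\<close> pair there, which rules out a second extreme
  vertex of either kind. The surplus \<open>+ 2\<close> for \<open>R\<close> then pays for
  \<open>v\<close>, which has no gray pair.\<close>

lemma gray_bound_isolated:
  assumes trirel: "trirel M N" and saturated: "saturated M N V" and fin: "finite V" and card: "card V \<ge> 3"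
    and v: "v \<in> V" "\<forall>u\<in>V - {v}. \<not> M v u"
    and IH: "\<And>R. R \<subset> V \<Longrightarrow> saturated M N R \<Longrightarrow> card R \<ge> 2 \<Longrightarrow> card R + 1 \<le> 3 * card (gray_pairs M N R)"
  shows "card V + 1 \<le> 3 * card (gray_pairs M N V)"
proof -
  define R where "R = V - {v}"
  have v': "\<not> M v u" if "u \<in> V" for u using v trirel_irrefl(1)[OF trirel, of v] that by (cases "u = v") auto
  have p3: "\<exists>a\<in>R. \<exists>b\<in>R. M d a \<and> M a b \<and> N d b" if "d \<in> R" for d
    using isolated_imp_p3_end[OF trirel saturated v(1) v', of d] that unfolding R_def by blast
  have satR: "saturated M N R"
    by (rule saturated_part[OF trirel saturated, of R "{v}"])
      (use v v' trirel_sym(1)[OF trirel] in \<open>auto simp: R_def\<close>)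
  have RV: "R \<subset> V" and finR: "finite R" and cardR: "card V = card R + 1"
    using v fin card by (auto simp: R_def)
  have "card R \<ge> 3"
  proof -
    have "R \<noteq> {}" using cardR card by auto
    then obtain d where d: "d \<in> R" by auto
    with p3 obtain a b where ab: "a \<in> R" "b \<in> R" "M d a" "M a b" "N d b" by blast
    have "card R \<noteq> 2"
    proof
      assume "card R = 2"
      then obtain p q where "R = {p, q}" by (auto simp: card_2_iff)
      then show False using ab d trirel_irrefl[OF trirel] by auto
    qed
    then show ?thesis using card cardR by simp
  qed
  from gray_bound_or_extreme_vertex[OF trirel satR finR this] RV IH
  have "card R + 2 \<le> 3 * card (gray_pairs M N R) \<or>
    (\<exists>v\<in>R. (\<forall>u\<in>R - {v}. \<not> M v u) \<or> (\<forall>u\<in>R - {v}. \<not> N v u))" by blast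
  moreover have "\<not> (\<exists>v\<in>R. (\<forall>u\<in>R - {v}. \<not> M v u) \<or> (\<forall>u\<in>R - {v}. \<not> N v u))"
    using p3 trirel_irrefl[OF trirel] by (metis Diff_iff singletonD)
  moreover have "card (gray_pairs M N R) \<le> card (gray_pairs M N V)"
    using RV by (intro card_mono finite_gray_pairs[OF fin] gray_pairs_mono) auto
  ultimately show ?thesis using cardR by linarith
qed

lemma gray_lower_bound:
  assumes "trirel M N" "finite V" "saturated M N V" "card V \<ge> 2"
  shows "card V + 1 \<le> 3 * card (gray_pairs M N V)"
  using assms(2-4)
proof (induction V rule: finite_psubset_induct)
  case (psubset V)
  note trirel = assms(1)
  have IH: "card R + 1 \<le> 3 * card (gray_pairs M N R)" if "R \<subset> V" "saturated M N R" "card R \<ge> 2" for R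
    using psubset that by blast
  show ?case
  proof (cases "card V = 2")
    case True
    then show ?thesis using saturated_two[OF trirel psubset.prems(1) psubset.hyps] by simp
  next
    case False
    then have card: "card V \<ge> 3" using psubset.prems by simp
    from gray_bound_or_extreme_vertex[OF trirel psubset.prems(1) psubset.hyps card IH]
    consider "card V + 2 \<le> 3 * card (gray_pairs M N V)"
      | v where "v \<in> V" "\<forall>u\<in>V - {v}. \<not> M v u" | v where "v \<in> V" "\<forall>u\<in>V - {v}. \<not> N v u"
      by blast
    then show ?thesis
    proof cases
      case 1
      then show ?thesis by simp
    next
      case (2 v)
      from gray_bound_isolated[OF trirel psubset.prems(1) psubset.hyps card 2 IH] show ?thesis by blast
    next
      case (3 v)
      from gray_bound_isolated[OF trirel_swap[OF trirel] _ psubset.hyps card 3] psubset.prems(1) IH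
      show ?thesis unfolding saturated_swap[OF trirel] gray_pairs_swap[of N M] by blast
    qed
  qed
qed


section \<open>Extensions that preserve saturation\<close>

lemma saturated_cong:
  assumes "\<And>u v. u \<in> V \<Longrightarrow> v \<in> V \<Longrightarrow> M u v = M' u v" "\<And>u v. u \<in> V \<Longrightarrow> v \<in> V \<Longrightarrow> N u v = N' u v"
  shows "saturated M N V = saturated M' N' V"
proof -
  have "has_p4 M N V = has_p4 M' N' V"
    if "\<And>u v. u \<in> V \<Longrightarrow> v \<in> V \<Longrightarrow> M u v = M' u v" "\<And>u v. u \<in> V \<Longrightarrow> v \<in> V \<Longrightarrow> N u v = N' u v"
    for M N M' N' :: "'a \<Rightarrow> 'a \<Rightarrow> bool"
    using that by (simp add: has_p4_def p4_def)
  note cong = this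
  have "has_p4 (add_pair u v M) (add_pair u v N) V = has_p4 (add_pair u v M') (add_pair u v N') V" for u v
    by (rule cong) (use assms in \<open>auto simp: add_pair_def\<close>)
  then show ?thesis using assms cong[of M M' N N'] by (simp add: saturated_def)
qed

text \<open>The complement of P_4 is connected, and \<open>N\<close> never links
  \<open>{x, y}\<close> to \<open>V\<close>, so no P_4 meets both. If \<open>x v\<close> becomes
  gray, a possible non-neighbour \<open>w\<close> of \<open>v\<close> gives the P_4
  \<open>x w y v\<close>; this is the purpose of the last hypothesis.\<close>

lemma saturated_join_pair:
  assumes trirel: "trirel M N" and saturated: "saturated M N V" and xy: "x \<notin> V" "y \<notin> V" "x \<noteq> y" "M x y" "N x y"
    and black: "\<And>v. v \<in> V \<Longrightarrow> \<not> N x v" "\<And>v. v \<in> V \<Longrightarrow> \<not> N y v"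
    and non: "\<And>v. v \<in> V \<Longrightarrow> \<exists>u\<in>V. N v u"
  shows "saturated M N (insert x (insert y V))"
  unfolding saturated_def
proof (intro conjI ballI impI)
  note sym = trirel_sym[OF trirel]
  have N_xy: "z \<in> {x, y} \<longleftrightarrow> z' \<in> {x, y}" if "N z z'" "{z, z'} \<subseteq> insert x (insert y V)" for z z'
    using that black[of z] black[of z'] sym(2)[of z z'] by auto
  show "\<not> has_p4 M N (insert x (insert y V))"
  proof
    assume "has_p4 M N (insert x (insert y V))"
    then obtain a b c d where V: "{a, b, c, d} \<subseteq> insert x (insert y V)" and p: "p4 M N a b c d"
      by (auto simp: has_p4_def)
    have N: "N a c" "N a d" "N b d" using p by (auto simp: p4_def)
    then have *: "a \<in> {x, y} \<longleftrightarrow> c \<in> {x, y}" "a \<in> {x, y} \<longleftrightarrow> d \<in> {x, y}" "b \<in> {x, y} \<longleftrightarrow> d \<in> {x, y}"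
      using N_xy V by blast+
    have "a \<noteq> c" "c \<noteq> d" "a \<noteq> d" using p trirel_irrefl[OF trirel] by (auto simp: p4_def)
    then have "a \<notin> {x, y}" using * by auto
    then have "{a, b, c, d} \<subseteq> V" using * V by auto
    then show False using saturated p by (auto simp: saturated_def has_p4_def)
  qed
  fix u v assume uv: "u \<in> insert x (insert y V)" "v \<in> insert x (insert y V)" "u \<noteq> v" "\<not> (M u v \<and> N u v)"
  let ?P = "\<lambda>u v. has_p4 (add_pair u v M) (add_pair u v N) (insert x (insert y V))"
  have comm: "add_pair u v A = add_pair v u A" for u v and A :: "'a \<Rightarrow> 'a \<Rightarrow> bool"
    by (auto simp: add_pair_def fun_eq_iff)
  have new: "?P x' v" if "{x', y'} = {x, y}" "v \<in> V" for x' y' v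
  proof -
    obtain w where w: "w \<in> V" "N v w" using non \<open>v \<in> V\<close> by blast
    have x': "x' \<notin> V" "y' \<notin> V" "N x' y'" and b: "\<And>v. v \<in> V \<Longrightarrow> \<not> N x' v" "\<And>v. v \<in> V \<Longrightarrow> \<not> N y' v"
      using that xy black sym by (auto simp: doubleton_eq_iff)
    then have "M x' w" "M w y'" "M y' v"
      using trirel_total[OF trirel, of x' w] trirel_total[OF trirel, of y' w] trirel_total[OF trirel, of y' v] w sym that(2)
      by metis+
    then have "p4 (add_pair x' v M) (add_pair x' v N) x' w y' v"
      using w x' sym(2)[of v w] by (auto simp: p4_def add_pair_def)
    moreover have "{x', w, y', v} \<subseteq> insert x (insert y V)" using that w by (auto simp: doubleton_eq_iff)
    ultimately show ?thesis by (rule has_p4I)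
  qed
  consider "u \<in> V" "v \<in> V" | "u \<in> {x, y}" "v \<in> V" | "u \<in> V" "v \<in> {x, y}"
    using uv xy sym by auto
  then show "?P u v"
  proof cases
    case 1
    then have "has_p4 (add_pair u v M) (add_pair u v N) V" using saturated uv by (auto simp: saturated_def)
    then show ?thesis by (rule has_p4_mono) auto
  next
    case 2
    then show ?thesis using new[of x y v] new[of y x v] by auto
  next
    case 3
    then have "?P v u" using new[of x y u] new[of y x u] by auto
    then show ?thesis by (simp only: comm[of u v])
  qed
qed

text \<open>Converse to \<open>isolated_imp_p3_end\<close>: graying \<open>z v\<close> prolongs the
  P_3 \<open>v a b\<close> to the P_4 \<open>z v a b\<close>.\<close>

lemma saturated_isolated:
  assumes trirel: "trirel M N" and saturated: "saturated M N V" and z: "z \<notin> V" "\<And>v. v \<in> V \<Longrightarrow> \<not> M z v"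
    and p3: "\<And>v. v \<in> V \<Longrightarrow> \<exists>a\<in>V. \<exists>b\<in>V. M v a \<and> M a b \<and> N v b"
  shows "saturated M N (insert z V)"
  unfolding saturated_def
proof (intro conjI ballI impI)
  note sym = trirel_sym[OF trirel]
  have M_z: "p \<in> V \<and> q \<in> V" if "M p q" "{p, q} \<subseteq> insert z V" for p q
    using that z(2)[of p] z(2)[of q] sym(1)[of p q] trirel_irrefl(1)[OF trirel, of z] by auto
  show "\<not> has_p4 M N (insert z V)"
  proof
    assume "has_p4 M N (insert z V)"
    then obtain a b c d where V: "{a, b, c, d} \<subseteq> insert z V" and p: "p4 M N a b c d"
      by (auto simp: has_p4_def)
    then have "{a, b, c, d} \<subseteq> V" using M_z[of a b] M_z[of c d] by (auto simp: p4_def)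
    then show False using saturated p by (auto simp: saturated_def has_p4_def)
  qed
  fix u v assume uv: "u \<in> insert z V" "v \<in> insert z V" "u \<noteq> v" "\<not> (M u v \<and> N u v)"
  let ?P = "\<lambda>u v. has_p4 (add_pair u v M) (add_pair u v N) (insert z V)"
  have comm: "add_pair u v A = add_pair v u A" for u v and A :: "'a \<Rightarrow> 'a \<Rightarrow> bool"
    by (auto simp: add_pair_def fun_eq_iff)
  have new: "?P z v" if "v \<in> V" for v
  proof -
    obtain a b where ab: "a \<in> V" "b \<in> V" "M v a" "M a b" "N v b" using p3 \<open>v \<in> V\<close> by blast
    then have "N z a" "N z b" using z trirel_total[OF trirel] by metis+
    then have "p4 (add_pair z v M) (add_pair z v N) z v a b" using ab by (auto simp: p4_def add_pair_def)
    then show ?thesis by (rule has_p4I) (use ab that in auto)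
  qed
  consider "u \<in> V" "v \<in> V" | "u = z" "v \<in> V" | "u \<in> V" "v = z"
    using uv by auto
  then show "?P u v"
  proof cases
    case 1
    then have "has_p4 (add_pair u v M) (add_pair u v N) V" using saturated uv by (auto simp: saturated_def)
    then show ?thesis by (rule has_p4_mono) auto
  next
    case 2
    then show ?thesis using new by auto
  next
    case 3
    then have "?P v u" using new by auto
    then show ?thesis by (simp only: comm[of u v])
  qed
qed

section \<open>The extremal trigraphs\<close>

text \<open>
  The extremal trigraph on \<open>{..<n}\<close>: the colour of a pair depends on its larger element \<open>v\<close> only,
  except that \<open>v\<close> with \<open>second_at m v\<close> forms a gray pair with its predecessor. Below \<open>m\<close> the vertices
  come in gray pairs, from \<open>m\<close> on in triples consisting of a gray pair and a vertex isolated at the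
  time it is added.
\<close>

definition second_at :: "nat \<Rightarrow> nat \<Rightarrow> bool" where
  "second_at m v \<longleftrightarrow> (if v < m then odd v else (v - m) mod 3 = 1)"

definition isolated_at :: "nat \<Rightarrow> nat \<Rightarrow> bool" where
  "isolated_at m v \<longleftrightarrow> v \<ge> m \<and> (v - m) mod 3 = 2"

definition may_ex :: "nat \<Rightarrow> nat \<Rightarrow> nat \<Rightarrow> bool" where
  "may_ex m u v \<longleftrightarrow> u \<noteq> v \<and> \<not> isolated_at m (max u v)"

definition may_not_ex :: "nat \<Rightarrow> nat \<Rightarrow> nat \<Rightarrow> bool" where
  "may_not_ex m u v \<longleftrightarrow> u \<noteq> v \<and> (isolated_at m (max u v) \<or> second_at m (max u v) \<and> max u v = Suc (min u v))"

lemma trirel_may_ex: "trirel (may_ex m) (may_not_ex m)"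
  by (auto simp: trirel_def may_ex_def may_not_ex_def max.commute min.commute)

text \<open>The middle condition is what \<open>saturated_join_pair\<close> asks of the set being
  extended. An upper estimate of the gray pairs suffices, as the lower bound is proved
  separately.\<close>

definition admissible :: "nat \<Rightarrow> nat \<Rightarrow> nat \<Rightarrow> bool" where
  "admissible m k g \<longleftrightarrow> saturated (may_ex m) (may_not_ex m) {..<k} \<and> (\<forall>v<k. \<exists>u<k. may_not_ex m v u) \<and>
     card (gray_pairs (may_ex m) (may_not_ex m) {..<k}) \<le> g"

lemma admissible_join_pair:
  assumes admissible: "admissible m k g"
    and k: "\<not> second_at m k" "\<not> isolated_at m k" "second_at m (Suc k)" "\<not> isolated_at m (Suc k)"
  shows "admissible m (Suc (Suc k)) (Suc g)"
proof -
  let ?M = "may_ex m" and ?N = "may_not_ex m"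
  have set: "{..<Suc (Suc k)} = insert k (insert (Suc k) {..<k})" by auto
  have black: "\<not> ?N k v" "\<not> ?N (Suc k) v" "\<not> ?N v k" "\<not> ?N v (Suc k)" if "v < k" for v
    using that k by (auto simp: may_not_ex_def max_def min_def)
  have gray: "?M k (Suc k)" "?N k (Suc k)" "?N (Suc k) k"
    using k by (auto simp: may_ex_def may_not_ex_def)
  have non: "\<exists>u<k. ?N v u" if "v < k" for v using admissible that by (auto simp: admissible_def)
  have "saturated ?M ?N {..<Suc (Suc k)}"
    unfolding set using admissible gray black non by (intro saturated_join_pair trirel_may_ex) (auto simp: admissible_def Bex_def)
  moreover have "\<exists>u<Suc (Suc k). ?N v u" if v: "v < Suc (Suc k)" for v
  proof -
    consider "v < k" | "v = k" | "v = Suc k" using v by linarith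
    then show ?thesis
    proof cases
      case 1
      then show ?thesis using non by (meson less_SucI)
    next
      case 2
      then show ?thesis using gray by blast
    next
      case 3
      then show ?thesis using gray by (intro exI[of _ k]) simp
    qed
  qed
  moreover have "card (gray_pairs ?M ?N {..<Suc (Suc k)}) \<le> Suc g"
  proof -
    have "gray_pairs ?M ?N {..<Suc (Suc k)} \<subseteq> insert {k, Suc k} (gray_pairs ?M ?N {..<k})"
    proof
      fix e assume "e \<in> gray_pairs ?M ?N {..<Suc (Suc k)}"
      then obtain u v where e: "e = {u, v}" "u < Suc (Suc k)" "v < Suc (Suc k)" "?M u v" "?N u v"
        by (auto simp: gray_pairs_def)
      then have "u \<noteq> v" by (auto simp: may_ex_def)
      then have "u < k \<and> v < k \<or> e = {k, Suc k}"
        using e black[of u] black[of v] by (auto simp: less_Suc_eq insert_commute)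
      then show "e \<in> insert {k, Suc k} (gray_pairs ?M ?N {..<k})" using e by (auto simp: gray_pairs_def)
    qed
    then have "card (gray_pairs ?M ?N {..<Suc (Suc k)}) \<le> card (insert {k, Suc k} (gray_pairs ?M ?N {..<k}))"
      by (intro card_mono) (auto intro: finite_gray_pairs)
    also have "\<dots> \<le> Suc (card (gray_pairs ?M ?N {..<k}))" by (rule card_insert_le_m1) simp_all
    finally show ?thesis using admissible by (simp add: admissible_def)
  qed
  ultimately show ?thesis by (simp add: admissible_def)
qed

text \<open>An old vertex \<open>v\<close> begins the P_3 \<open>v k u\<close> with \<open>u\<close>
  a possible non-neighbour of \<open>v\<close>. The vertices \<open>k\<close> and
  \<open>Suc k\<close> are the ends of a P_3 through \<open>0\<close>, whence
  \<open>k > 0\<close>.\<close>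

lemma admissible_join_pair_isolated:
  assumes admissible: "admissible m k g" and pos: "k > 0"
    and k: "\<not> second_at m k" "\<not> isolated_at m k" "second_at m (Suc k)" "\<not> isolated_at m (Suc k)" "isolated_at m (Suc (Suc k))"
  shows "admissible m (Suc (Suc (Suc k))) (Suc g)"
proof -
  let ?M = "may_ex m" and ?N = "may_not_ex m" and ?z = "Suc (Suc k)"
  have admissible': "admissible m ?z (Suc g)" using admissible_join_pair[OF admissible k(1-4)] .
  have set: "{..<Suc ?z} = insert ?z {..<?z}" by auto
  have white: "\<not> ?M ?z v" "\<not> ?M v ?z" "?N ?z v" "?N v ?z" if "v < ?z" for v
    using that k by (auto simp: may_ex_def may_not_ex_def max_def)
  have M: "?M k v" "?M v k" "?M (Suc k) v" "?M v (Suc k)" if "v < k" for v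
    using that k by (auto simp: may_ex_def max_def)
  have N: "?N k (Suc k)" "?N (Suc k) k" using k by (auto simp: may_not_ex_def)
  have p3: "\<exists>a<?z. \<exists>b<?z. ?M v a \<and> ?M a b \<and> ?N v b" if v: "v < ?z" for v
  proof -
    consider "v < k" | "v = k" | "v = Suc k" using v by linarith
    then show ?thesis
    proof cases
      case 1
      then obtain u where "u < k" "?N v u" using admissible by (auto simp: admissible_def)
      then show ?thesis using 1 M by (intro exI[of _ k] exI[of _ u] conjI) auto
    next
      case 2
      then show ?thesis using pos M N by (intro exI[of _ 0] exI[of _ "Suc k"] conjI) auto
    next
      case 3
      then show ?thesis using pos M N by (intro exI[of _ 0] exI[of _ k] conjI) auto
    qed
  qed
  have "saturated ?M ?N {..<Suc ?z}"
    unfolding set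
  proof (rule saturated_isolated[OF trirel_may_ex])
    show "\<exists>a\<in>{..<?z}. \<exists>b\<in>{..<?z}. ?M v a \<and> ?M a b \<and> ?N v b" if "v \<in> {..<?z}" for v
      using p3[of v] that unfolding Bex_def lessThan_iff by blast
  qed (use admissible' white in \<open>auto simp: admissible_def\<close>)
  moreover have "\<exists>u<Suc ?z. ?N v u" if v: "v < Suc ?z" for v
  proof (cases "v = ?z")
    case True
    then show ?thesis using white(3)[of k] by (intro exI[of _ k]) auto
  next
    case False
    then show ?thesis using white(4)[of v] v by (intro exI[of _ ?z]) auto
  qed
  moreover have "gray_pairs ?M ?N {..<Suc ?z} = gray_pairs ?M ?N {..<?z}"
  proof
    show "gray_pairs ?M ?N {..<Suc ?z} \<subseteq> gray_pairs ?M ?N {..<?z}"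
    proof
      fix e assume "e \<in> gray_pairs ?M ?N {..<Suc ?z}"
      then obtain u v where e: "e = {u, v}" "u < Suc ?z" "v < Suc ?z" "?M u v" "?N u v"
        by (auto simp: gray_pairs_def)
      moreover have "u \<noteq> v" using e by (auto simp: may_ex_def)
      ultimately have "u < ?z \<and> v < ?z" using white[of u] white[of v] by (metis less_SucE)
      then show "e \<in> gray_pairs ?M ?N {..<?z}" using e by (auto simp: gray_pairs_def)
    qed
  qed (rule gray_pairs_mono, auto)
  ultimately show ?thesis using admissible' by (simp add: admissible_def)
qed

lemma admissible_base:
  assumes "m \<ge> 2"
  shows "admissible m 2 1"
proof -
  let ?M = "may_ex m" and ?N = "may_not_ex m"
  have set: "{..<2::nat} = {0, 1}" by auto
  have gray: "?M 0 1" "?M 1 0" "?N 0 1" "?N 1 0" and irr: "\<not> ?M v v" "\<not> ?N v v" for v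
    using assms by (auto simp: may_ex_def may_not_ex_def isolated_at_def second_at_def max_def min_def)
  have "\<not> has_p4 ?M ?N {0, 1}"
    using irr by (auto simp: has_p4_def p4_def)
  then have "saturated ?M ?N {..<2}" using gray unfolding set by (auto simp: saturated_def)
  moreover have "\<exists>u<2. ?N v u" if "v < 2" for v
  proof -
    from that consider "v = 0" | "v = 1" by linarith
    then show ?thesis
    proof cases
      case 1
      then show ?thesis using gray by (intro exI[of _ 1]) simp
    next
      case 2
      then show ?thesis using gray by (intro exI[of _ 0]) simp
    qed
  qed
  moreover have "gray_pairs ?M ?N {..<2} \<subseteq> {{0, 1}}"
    using irr by (auto simp: gray_pairs_def set)
  then have "card (gray_pairs ?M ?N {..<2}) \<le> card {{0, 1::nat}}" by (intro card_mono) auto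
  ultimately show ?thesis by (simp add: admissible_def)
qed

lemma admissible_iterate:
  assumes "admissible m m g" "m > 0"
  shows "admissible m (m + 3 * j) (g + j)"
proof (induction j)
  case (Suc j)
  have "admissible m (Suc (Suc (Suc (m + 3 * j)))) (Suc (g + j))"
    using assms(2) by (intro admissible_join_pair_isolated Suc) (auto simp: second_at_def isolated_at_def Suc_diff_le mod_Suc)
  then show ?case by (simp add: eval_nat_numeral)
qed (use assms in simp)

lemma admissible_even:
  assumes "even m" "Suc (2 * i) < m"
  shows "admissible m (2 * Suc i) (Suc i)"
  using assms(2)
proof (induction i)
  case 0
  then show ?case using admissible_base[of m] by simp
next
  case (Suc i)
  then have "admissible m (2 * Suc i) (Suc i)" by simp
  then have "admissible m (Suc (Suc (2 * Suc i))) (Suc (Suc i))"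
    by (rule admissible_join_pair) (use Suc.prems in \<open>auto simp: second_at_def isolated_at_def\<close>)
  then show ?case by simp
qed

text \<open>The residue of \<open>n\<close> modulo 3 decides whether to start with one, two or three
  gray pairs, that is \<open>m\<close> = 2, 4 or 6; triples follow. With at most three such pairs,
  rounding absorbs their lower yield of two vertices per gray pair.\<close>

lemma admissible_exists:
  assumes "n \<ge> 4"
  shows "\<exists>m. admissible m n ((n + 3) div 3)"
proof -
  have *: "\<exists>m. admissible m n ((n + 3) div 3)"
    if "n = 2 * Suc i + 3 * j" "i \<le> 2" for i j
  proof -
    have "admissible (2 * Suc i) (2 * Suc i) (Suc i)" by (rule admissible_even) auto
    then have "admissible (2 * Suc i) n (Suc i + j)" using admissible_iterate[of "2 * Suc i" "Suc i" j] that by simp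
    moreover have "Suc i + j = (n + 3) div 3"
    proof -
      have "i = 0 \<or> i = 1 \<or> i = 2" using that by linarith
      then show ?thesis using that by auto
    qed
    ultimately show ?thesis by auto
  qed
  consider "n mod 3 = 2" | "n mod 3 = 1" | "n mod 3 = 0" by linarith
  then show ?thesis
  proof cases
    case 1
    then have "n = 2 * Suc 0 + 3 * ((n - 2) div 3)" using assms by presburger
    then show ?thesis by (rule *) simp
  next
    case 2
    then have "n = 2 * Suc 1 + 3 * ((n - 4) div 3)" using assms by presburger
    then show ?thesis by (rule *) simp
  next
    case 3
    then have "n = 2 * Suc 2 + 3 * ((n - 6) div 3)" using assms by presburger
    then show ?thesis by (rule *) simp
  qed
qed

section \<open>Translation between trigraphs and relations\<close>

text \<open>Definition by exclusion makes \<open>trirel\<close> hold on the whole type. Pairs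
  leaving \<open>tverts T\<close> then look gray, which is harmless because only pairs inside the
  vertex set are inspected.\<close>

definition may_edge :: "'a trigraph \<Rightarrow> 'a \<Rightarrow> 'a \<Rightarrow> bool" where
  "may_edge T u v \<longleftrightarrow> u \<noteq> v \<and> {u, v} \<notin> white T"

definition may_nonedge :: "'a trigraph \<Rightarrow> 'a \<Rightarrow> 'a \<Rightarrow> bool" where
  "may_nonedge T u v \<longleftrightarrow> u \<noteq> v \<and> {u, v} \<notin> black T"

lemma trirel_may_edge: "is_trigraph T \<Longrightarrow> trirel (may_edge T) (may_nonedge T)"
  by (auto simp: trirel_def may_edge_def may_nonedge_def is_trigraph_def insert_commute)

lemma trigraph_pairs:
  assumes "is_trigraph T" "u \<in> tverts T" "v \<in> tverts T" "u \<noteq> v"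
  shows "{u, v} \<in> black T \<or> {u, v} \<in> white T \<or> {u, v} \<in> gray T"
proof -
  have "{u, v} \<in> vertex_pairs (tverts T)" using assms by (auto simp: vertex_pairs_def)
  then show ?thesis using assms(1) unfolding is_trigraph_def by blast
qed

lemma vertex_pairs_no_loop: "{u} \<notin> vertex_pairs V"
  by (auto simp: vertex_pairs_def)

lemma gray_pairs_may_edge:
  assumes T: "is_trigraph T"
  shows "gray_pairs (may_edge T) (may_nonedge T) (tverts T) = gray T"
proof
  show "gray_pairs (may_edge T) (may_nonedge T) (tverts T) \<subseteq> gray T"
    using trigraph_pairs[OF T] by (auto simp: gray_pairs_def may_edge_def may_nonedge_def)
  show "gray T \<subseteq> gray_pairs (may_edge T) (may_nonedge T) (tverts T)"
  proof
    fix e assume e: "e \<in> gray T"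
    then have "e \<in> vertex_pairs (tverts T)" "e \<notin> black T" "e \<notin> white T"
      using T unfolding is_trigraph_def by blast+
    then show "e \<in> gray_pairs (may_edge T) (may_nonedge T) (tverts T)"
      by (auto simp: gray_pairs_def may_edge_def may_nonedge_def vertex_pairs_def)
  qed
qed

lemma edges_path_4: "edges (path_graph 4) = {{0, 1}, {1, 2}, {2, 3}}"
proof -
  have "Suc i < 4 \<longleftrightarrow> i = 0 \<or> i = 1 \<or> i = 2" for i by auto
  then show ?thesis by (auto simp: path_graph_def numeral_2_eq_2 numeral_3_eq_3)
qed

lemma verts_path_4: "verts (path_graph 4) = {0, 1, 2, 3}"
  by (auto simp: path_graph_def)

lemma contains_induced_iff:
  "contains_induced G H \<longleftrightarrow> (\<exists>W f. W \<subseteq> verts G \<and> bij_betw f (verts H) W \<and>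
    (\<forall>u\<in>verts H. \<forall>v\<in>verts H.
      {u, v} \<in> edges H \<longleftrightarrow> {f u, f v} \<in> edges G \<and> {f u, f v} \<subseteq> W))"
  by (simp add: contains_induced_def graph_iso_def induced_subgraph_def)

lemma contains_induced_p4:
  assumes "edges G \<subseteq> vertex_pairs (verts G)"
  shows "contains_induced G (path_graph 4) \<longleftrightarrow>
    (\<exists>a\<in>verts G. \<exists>b\<in>verts G. \<exists>c\<in>verts G. \<exists>d\<in>verts G. distinct [a, b, c, d] \<and>
      {a, b} \<in> edges G \<and> {b, c} \<in> edges G \<and> {c, d} \<in> edges G \<and>
      {a, c} \<notin> edges G \<and> {b, d} \<notin> edges G \<and> {a, d} \<notin> edges G)" (is "?L \<longleftrightarrow> ?R")
proof
  assume ?L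
  then obtain W f where W: "W \<subseteq> verts G" and f: "bij_betw f {0, 1, 2, 3} W"
    and e: "\<forall>u\<in>{0, 1, 2, 3}. \<forall>v\<in>{0, 1, 2, 3}.
      {u, v} \<in> {{0, 1}, {1, 2}, {2, 3::nat}} \<longleftrightarrow> {f u, f v} \<in> edges G \<and> {f u, f v} \<subseteq> W"
    unfolding contains_induced_iff edges_path_4 verts_path_4
    by (elim exE conjE) (rule that, assumption+)
  have fW: "f 0 \<in> W" "f 1 \<in> W" "f 2 \<in> W" "f 3 \<in> W" using f by (auto simp: bij_betw_def)
  have "distinct [f 0, f 1, f 2, f 3]" using f by (auto simp: bij_betw_def inj_on_def)
  moreover have "{f 0, f 1} \<in> edges G" "{f 1, f 2} \<in> edges G" "{f 2, f 3} \<in> edges G"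
    "{f 0, f 2} \<notin> edges G" "{f 1, f 3} \<notin> edges G" "{f 0, f 3} \<notin> edges G"
    using e[rule_format, of 0 1] e[rule_format, of 1 2] e[rule_format, of 2 3]
      e[rule_format, of 0 2] e[rule_format, of 1 3] e[rule_format, of 0 3] fW
    by (simp_all add: doubleton_eq_iff)
  moreover have "f 0 \<in> verts G" "f 1 \<in> verts G" "f 2 \<in> verts G" "f 3 \<in> verts G"
    using fW W by blast+
  ultimately show ?R
    by - (rule bexI[of _ "f 0"], rule bexI[of _ "f 1"], rule bexI[of _ "f 2"], rule bexI[of _ "f 3"],
      simp_all)
next
  assume ?R
  then obtain a b c d where V: "{a, b, c, d} \<subseteq> verts G" and dist: "distinct [a, b, c, d]"
    and e: "{a, b} \<in> edges G" "{b, c} \<in> edges G" "{c, d} \<in> edges G"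
      "{a, c} \<notin> edges G" "{b, d} \<notin> edges G" "{a, d} \<notin> edges G" by blast
  define f where "f = (\<lambda>i::nat. if i = 0 then a else if i = 1 then b else if i = 2 then c else d :: 'a)"
  have f: "f 0 = a" "f 1 = b" "f (Suc 0) = b" "f 2 = c" "f 3 = d" by (simp_all add: f_def)
  have e': "{b, a} \<in> edges G" "{c, b} \<in> edges G" "{d, c} \<in> edges G"
    "{c, a} \<notin> edges G" "{d, b} \<notin> edges G" "{d, a} \<notin> edges G"
    using e by (simp_all add: insert_commute)
  \<comment> \<open>The isomorphism condition also ranges over \<open>u = v\<close>, so it must be
    known that \<open>G\<close> has no loops.\<close>
  have loop: "{v} \<notin> edges G" for v using subsetD[OF assms, of "{v}"] vertex_pairs_no_loop[of v "verts G"] by auto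
  have "bij_betw f {0, 1, 2, 3::nat} {a, b, c, d}"
    using dist by (auto simp: bij_betw_def inj_on_def f)
  moreover have "{u, v} \<in> {{0, 1}, {1, 2}, {2, 3::nat}} \<longleftrightarrow> {f u, f v} \<in> edges G \<and> {f u, f v} \<subseteq> {a, b, c, d}"
    if "u \<in> {0, 1, 2, 3}" "v \<in> {0, 1, 2, 3}" for u v
    using that by (elim insertE emptyE; simp add: f e e' loop doubleton_eq_iff)
  ultimately show ?L
    unfolding contains_induced_iff edges_path_4 verts_path_4
    using V by (intro exI[of _ "{a, b, c, d}"] conjI exI[of _ f]) simp_all
qed

text \<open>The six pairs on four vertices are distinct, so gray ones can be decided independently
  of each other.\<close>

lemma realization_p4:
  assumes T: "is_trigraph T"
  shows "(\<exists>G. is_realization G T \<and> contains_induced G (path_graph 4)) \<longleftrightarrow>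
    has_p4 (may_edge T) (may_nonedge T) (tverts T)" (is "?L \<longleftrightarrow> ?R")
proof
  assume ?L
  then obtain G :: "'a graph" and S where G: "verts G = tverts T" "edges G = black T \<union> S" "S \<subseteq> gray T"
    and p4: "contains_induced G (path_graph 4)" by (auto simp: is_realization_def)
  have "edges G \<subseteq> vertex_pairs (verts G)" using G T unfolding is_trigraph_def by auto
  from p4 obtain a b c d where V: "{a, b, c, d} \<subseteq> tverts T" and dist: "distinct [a, b, c, d]"
    and e: "{a, b} \<in> edges G" "{b, c} \<in> edges G" "{c, d} \<in> edges G"
      "{a, c} \<notin> edges G" "{b, d} \<notin> edges G" "{a, d} \<notin> edges G"
    unfolding contains_induced_p4[OF \<open>edges G \<subseteq> vertex_pairs (verts G)\<close>] G(1) by blast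
  have "e \<notin> white T" if "e \<in> edges G" for e using that G T unfolding is_trigraph_def by blast
  moreover have "e \<notin> black T" if "e \<notin> edges G" for e using that G by blast
  ultimately have "p4 (may_edge T) (may_nonedge T) a b c d"
    using e dist by (simp add: p4_def may_edge_def may_nonedge_def)
  then show ?R using V by (rule has_p4I)
next
  assume ?R
  then obtain a b c d where V: "{a, b, c, d} \<subseteq> tverts T" and p: "p4 (may_edge T) (may_nonedge T) a b c d"
    by (auto simp: has_p4_def)
  \<comment> \<open>Exactly the gray pairs wanted as path edges become edges; gray pairs among the
    other three stay non-edges.\<close>
  define S where "S = gray T \<inter> {{a, b}, {b, c}, {c, d}}"
  define G where "G = \<lparr>verts = tverts T, edges = black T \<union> S\<rparr>"
  have sub: "edges G \<subseteq> vertex_pairs (verts G)"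
    using T unfolding is_trigraph_def G_def S_def by auto
  have dist: "distinct [a, b, c, d]" using p by (auto simp: p4_def may_edge_def may_nonedge_def)
  have "{a, b} \<in> edges G" "{b, c} \<in> edges G" "{c, d} \<in> edges G"
    using p V trigraph_pairs[OF T, of a b] trigraph_pairs[OF T, of b c] trigraph_pairs[OF T, of c d]
    by (auto simp: p4_def may_edge_def G_def S_def)
  moreover have "{a, c} \<notin> edges G" "{b, d} \<notin> edges G" "{a, d} \<notin> edges G"
    using p dist by (auto simp: p4_def may_nonedge_def G_def S_def doubleton_eq_iff)
  moreover have "a \<in> verts G" "b \<in> verts G" "c \<in> verts G" "d \<in> verts G"
    using V by (simp_all add: G_def)
  ultimately have "contains_induced G (path_graph 4)"
    unfolding contains_induced_p4[OF sub] using dist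
    by - (rule bexI[of _ a], rule bexI[of _ b], rule bexI[of _ c], rule bexI[of _ d], simp_all)
  moreover have "is_realization G T"
    unfolding is_realization_def by (intro conjI exI[of _ S]) (simp_all add: G_def S_def)
  ultimately show ?L by blast
qed

lemma change_to_gray_trigraph:
  assumes "is_trigraph T" "e \<in> black T \<union> white T"
  shows "is_trigraph (change_to_gray e T)"
  using assms unfolding is_trigraph_def change_to_gray_def by auto

lemma may_change_to_gray:
  assumes "u \<noteq> v"
  shows "may_edge (change_to_gray {u, v} T) = add_pair u v (may_edge T)"
    and "may_nonedge (change_to_gray {u, v} T) = add_pair u v (may_nonedge T)"
  using assms by (auto simp: fun_eq_iff may_edge_def may_nonedge_def add_pair_def change_to_gray_def doubleton_eq_iff)

lemma induced_saturated_p4: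
  assumes T: "is_trigraph T"
  shows "induced_saturated (path_graph 4) T \<longleftrightarrow> saturated (may_edge T) (may_nonedge T) (tverts T)"
proof -
  have free: "(\<forall>G. is_realization G T \<longrightarrow> \<not> contains_induced G (path_graph 4)) \<longleftrightarrow>
      \<not> has_p4 (may_edge T) (may_nonedge T) (tverts T)"
    using realization_p4[OF T] by blast
  have verts: "tverts (change_to_gray e T) = tverts T" for e by (simp add: change_to_gray_def)
  let ?C = "\<lambda>e. \<exists>G. is_realization G (change_to_gray e T) \<and> contains_induced G (path_graph 4)"
  have change: "?C {u, v} \<longleftrightarrow> has_p4 (add_pair u v (may_edge T)) (add_pair u v (may_nonedge T)) (tverts T)"
    if "{u, v} \<in> black T \<union> white T" "u \<noteq> v" for u v
    unfolding realization_p4[OF change_to_gray_trigraph[OF T that(1)]]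
      may_change_to_gray[OF that(2)] verts ..
  have pair: "\<exists>u v. e = {u, v} \<and> u \<in> tverts T \<and> v \<in> tverts T \<and> u \<noteq> v" if "e \<in> black T \<union> white T" for e
    using that T unfolding is_trigraph_def vertex_pairs_def by blast
  have "(\<forall>e\<in>black T \<union> white T. ?C e) \<longleftrightarrow>
      (\<forall>u\<in>tverts T. \<forall>v\<in>tverts T. u \<noteq> v \<longrightarrow> \<not> (may_edge T u v \<and> may_nonedge T u v) \<longrightarrow>
        has_p4 (add_pair u v (may_edge T)) (add_pair u v (may_nonedge T)) (tverts T))" (is "?A \<longleftrightarrow> ?B")
  proof
    assume A: ?A
    show ?B
    proof (intro ballI impI)
      fix u v assume "u \<noteq> v" "\<not> (may_edge T u v \<and> may_nonedge T u v)"
      then have "{u, v} \<in> black T \<union> white T" by (auto simp: may_edge_def may_nonedge_def)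
      then show "has_p4 (add_pair u v (may_edge T)) (add_pair u v (may_nonedge T)) (tverts T)"
        using A change \<open>u \<noteq> v\<close> by blast
    qed
  next
    assume B: ?B
    show ?A
    proof
      fix e assume e: "e \<in> black T \<union> white T"
      then obtain u v where uv: "e = {u, v}" "u \<in> tverts T" "v \<in> tverts T" "u \<noteq> v" using pair by blast
      then have "\<not> (may_edge T u v \<and> may_nonedge T u v)" using e by (auto simp: may_edge_def may_nonedge_def)
      then show "?C e" using B uv e change[of u v] by blast
    qed
  qed
  then show ?thesis unfolding induced_saturated_def saturated_def free using T by blast
qed

lemma trigraph_of_relations:
  assumes trirel: "trirel M N" and fin: "finite V" and saturated: "saturated M N V"
  shows "\<exists>T. tverts T = V \<and> induced_saturated (path_graph 4) T \<and> gray T = gray_pairs M N V"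
proof -
  define T where "T = \<lparr>tverts = V, black = {{u, v} | u v. u \<in> V \<and> v \<in> V \<and> u \<noteq> v \<and> \<not> N u v},
    white = {{u, v} | u v. u \<in> V \<and> v \<in> V \<and> u \<noteq> v \<and> \<not> M u v}, gray = gray_pairs M N V\<rparr>"
  note sym = trirel_sym[OF trirel] and irrefl = trirel_irrefl[OF trirel] and total = trirel_total[OF trirel]
  have black: "{u, v} \<in> black T \<longleftrightarrow> u \<in> V \<and> v \<in> V \<and> u \<noteq> v \<and> \<not> N u v" for u v
    using sym(2)[of u v] by (auto simp: T_def doubleton_eq_iff)
  have white: "{u, v} \<in> white T \<longleftrightarrow> u \<in> V \<and> v \<in> V \<and> u \<noteq> v \<and> \<not> M u v" for u v
    using sym(1)[of u v] by (auto simp: T_def doubleton_eq_iff)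
  have gray: "{u, v} \<in> gray T \<longleftrightarrow> u \<in> V \<and> v \<in> V \<and> M u v \<and> N u v" for u v
    using sym(1)[of u v] sym(2)[of u v] by (auto simp: T_def gray_pairs_def doubleton_eq_iff)
  have pairs: "black T \<subseteq> vertex_pairs V" "white T \<subseteq> vertex_pairs V" "gray T \<subseteq> vertex_pairs V"
    using irrefl by (simp_all add: T_def vertex_pairs_def gray_pairs_def) blast+
  have verts: "tverts T = V" by (simp add: T_def)
  have is_T: "is_trigraph T"
    unfolding is_trigraph_def verts
  proof (intro conjI)
    have *: "\<not> (e \<in> black T \<and> e \<in> white T) \<and> \<not> (e \<in> black T \<and> e \<in> gray T) \<and> \<not> (e \<in> white T \<and> e \<in> gray T)
      \<and> (e \<in> black T \<or> e \<in> white T \<or> e \<in> gray T)" if "e \<in> vertex_pairs V" for e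
    proof -
      from that obtain u v where "e = {u, v}" "u \<in> V" "v \<in> V" "u \<noteq> v" by (auto simp: vertex_pairs_def)
      then show ?thesis using total[of u v] black white gray by auto
    qed
    show "black T \<union> white T \<union> gray T = vertex_pairs V" using * pairs by blast
    show "black T \<inter> white T = {}" "black T \<inter> gray T = {}" "white T \<inter> gray T = {}" using * pairs by blast+
  qed (rule fin)
  have "may_edge T u v = M u v" "may_nonedge T u v = N u v" if "u \<in> V" "v \<in> V" for u v
    using that black white irrefl by (auto simp: may_edge_def may_nonedge_def)
  \<comment> \<open>The relations of \<open>T\<close> agree with \<open>M\<close> and
    \<open>N\<close> only inside \<open>V\<close>, hence the congruence rule.\<close>
  then have "saturated (may_edge T) (may_nonedge T) V" using saturated saturated_cong[of V "may_edge T" M "may_nonedge T" N] by blast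
  then have "induced_saturated (path_graph 4) T" using induced_saturated_p4[OF is_T] verts by simp
  moreover have "gray T = gray_pairs M N V" by (simp add: T_def)
  ultimately show ?thesis using verts by blast
qed

theorem theorem1p3:
  fixes n :: nat
  assumes "n \<ge> 4"
  shows "int (indsat n (path_graph 4)) = \<lceil>(real n + 1) / 3\<rceil>"
proof -
  \<comment> \<open>Integer form of the ceiling of (n + 1) / 3.\<close>
  let ?k = "(n + 3) div 3"
  let ?S = "{card (gray T) | T :: nat trigraph. card (tverts T) = n \<and> induced_saturated (path_graph 4) T}"
  have lower: "?k \<le> g" if "g \<in> ?S" for g
  proof -
    from that obtain T :: "nat trigraph" where T: "card (tverts T) = n"
      "induced_saturated (path_graph 4) T" "g = card (gray T)" by auto
    then have is_T: "is_trigraph T" by (auto simp: induced_saturated_def)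
    then have "finite (tverts T)" by (auto simp: is_trigraph_def)
    from gray_lower_bound[OF trirel_may_edge[OF is_T] this] T is_T assms
    have "n + 1 \<le> 3 * g" by (simp add: induced_saturated_p4 gray_pairs_may_edge)
    then show ?thesis by linarith
  qed
  obtain m where "admissible m n ?k" using admissible_exists[OF assms] by blast
  then have m: "saturated (may_ex m) (may_not_ex m) {..<n}" "card (gray_pairs (may_ex m) (may_not_ex m) {..<n}) \<le> ?k"
    by (auto simp: admissible_def)
  from trigraph_of_relations[OF trirel_may_ex _ m(1)] obtain T where T: "tverts T = {..<n}"
    "induced_saturated (path_graph 4) T" "gray T = gray_pairs (may_ex m) (may_not_ex m) {..<n}" by auto
  \<comment> \<open>This member also shows that \<open>?S\<close> is nonempty, so that
    \<open>Inf ?S\<close> is attained rather than a default value.\<close>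
  then have g: "card (gray T) \<in> ?S" by (intro CollectI exI[of _ T]) simp
  have "indsat n (path_graph 4) = ?k"
    unfolding indsat_def
  proof (rule antisym)
    show "Inf ?S \<le> ?k" using wellorder_Inf_le1[OF g] m(2) T(3) by simp
    show "?k \<le> Inf ?S" using lower Inf_nat_def1[of ?S] g by blast
  qed
  moreover have "\<lceil>(real n + 1) / 3\<rceil> = int ?k"
  proof (rule ceiling_unique)
    have "3 * ?k < n + 4" "n + 1 \<le> 3 * ?k" by linarith+
    then show "real_of_int (int ?k) - 1 < (real n + 1) / 3" "(real n + 1) / 3 \<le> real_of_int (int ?k)"
      by (simp_all add: field_simps)
  qed
  ultimately show ?thesis by simp
qed

end
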